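(* Let $p,q\ge1$, $n=p+q$, let $\gamma$ be a $(p,q)$-clan, $v=v_\gamma$, and $1\le a<b\le n$. The $T$-stable curve $\eta$ through $V^v_\bullet$ and $V^{vt_{ab}}_\bullet$ (the one starting from $v$ with weight $y_{v(a)}-y_{v(b)}$) is contained in $Y_\gamma$ if and only if one of the following holds: (1) $\max\{v(a),v(b)\}\le p$ or $\min\{v(a),v(b)\}>p$; (2) $v(a)\le p<v(b)$ and $\gamma$ has an arc $(i,j)$ with $i\le a<b\le j$.
   Context: Work over $\mathbb{C}$. $Fl_n=GL_n/B$ ($B$ upper triangular), $K=GL_p\times GL_q$ block-diagonal. For $u\in S_n$, $V^u_\bullet$ is the flag with $V^u_i=\mathrm{span}(e_{u(1)},\ldots,e_{u(i)})$; $t_{ab}$ is the transposition of $a,b$. The curve $\eta$ is the closure of the image of $z\mapsto A(z)B/B$, $z\in\mathbb{C}$, where the $i$-th column of $A(z)$ is $e_{v(i)}+z\delta_{ia}e_{v(b)}$. A $(p,q)$-clan has nodes $1,\ldots,n$, pairwise disjoint pairs $(i,j)$, $i<j$ (arcs), and a sign $\pm$ on each other node, with $\#\{+\}-\#\{-\}=p-q$. $v_\gamma\in S_n$: label nodes that are $+$ or left endpoints by $1,\ldots,p$ left to right, nodes that are $-$ or right endpoints by $p+1,\ldots,n$; $v_\gamma(i)$ = label of node $i$. $V^\gamma_\bullet$ has $V^\gamma_i=V^\gamma_{i-1}\oplus\mathbb{C}\mathbf{v}_i$, $\mathbf{v}_i=e_{v_\gamma(i)}+e_{v_\gamma(j)}$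 if $(i,j)$ is an arc, else $e_{v_\gamma(i)}$; $Y_\gamma$ is the closure of the $K$-orbit of $V^\gamma_\bullet$. *)

theory Defs
  imports "HOL-Analysis.Abstract_Topology" "Jordan_Normal_Form.VS_Connect"
begin

text \<open>Nodes, labels and basis vectors are numbered from 1, as in the mathematics; the matrices and
  vectors of the library are indexed from 0, so that label \<open>k\<close> is coordinate \<open>k - 1\<close>.\<close>


section \<open>The flag variety\<close>

definition GL :: "nat \<Rightarrow> complex mat set" where
  "GL n = {g \<in> carrier_mat n n. invertible_mat g}"

type_synonym flag = "nat \<Rightarrow> complex vec set"

text \<open>\<open>flag_of n g\<close> is the complete flag whose \<open>i\<close>-th space is spanned by the first \<open>i\<close> columns of
  \<open>g\<close>. Two invertible matrices have the same flag iff they differ by an invertible upper triangular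
  matrix on the right, so on \<open>GL n\<close> this is the quotient map \<open>g \<mapsto> gB/B\<close>. For \<open>i > n\<close> the list
  \<open>take i (cols g)\<close> is \<open>cols g\<close>, so a flag stays constant beyond \<open>n\<close>.\<close>

definition flag_of :: "nat \<Rightarrow> complex mat \<Rightarrow> flag" where
  "flag_of n g = (\<lambda>i. LinearCombinations.module.span class_ring (module_vec TYPE(complex) n)
                         (set (take i (cols g))))"

definition Fl :: "nat \<Rightarrow> flag set" where
  "Fl n = flag_of n ` GL n"

text \<open>Polynomial functions in the entries of an \<open>n \<times> n\<close> matrix.\<close>

inductive_set matrix_polyfun :: "nat \<Rightarrow> (complex mat \<Rightarrow> complex) set" for n :: nat where
  const: "(\<lambda>_. c) \<in> matrix_polyfun n"
| entry: "i < n \<Longrightarrow> j < n \<Longrightarrow> (\<lambda>g. g $$ (i, j)) \<in> matrix_polyfun n"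
| add: "f \<in> matrix_polyfun n \<Longrightarrow> h \<in> matrix_polyfun n \<Longrightarrow> (\<lambda>g. f g + h g) \<in> matrix_polyfun n"
| mult: "f \<in> matrix_polyfun n \<Longrightarrow> h \<in> matrix_polyfun n \<Longrightarrow> (\<lambda>g. f g * h g) \<in> matrix_polyfun n"

text \<open>The Zariski topology on \<open>GL n\<close>. Regular functions on \<open>GL n\<close> are polynomial functions
  divided by powers of the determinant, so polynomial functions already cut out all closed sets.\<close>

definition GL_zariski :: "nat \<Rightarrow> complex mat topology" where
  "GL_zariski n =
     topology (\<lambda>U. \<exists>F \<subseteq> matrix_polyfun n. U = {g \<in> GL n. \<exists>f\<in>F. f g \<noteq> 0})"

text \<open>The Zariski topology on the flag variety: since \<open>GL n \<rightarrow> GL n / B\<close> is open and surjective, it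
  is the quotient topology.\<close>

definition Fl_zariski :: "nat \<Rightarrow> flag topology" where
  "Fl_zariski n =
     topology (\<lambda>U. U \<subseteq> Fl n \<and> openin (GL_zariski n) {g \<in> GL n. flag_of n g \<in> U})"

lemma istopology_GL_zariski:
  "istopology (\<lambda>U. \<exists>F \<subseteq> matrix_polyfun n. U = {g \<in> GL n. \<exists>f\<in>F. f g \<noteq> 0})"
  unfolding istopology_def
proof (intro conjI allI impI)
  fix S T
  assume "\<exists>F \<subseteq> matrix_polyfun n. S = {g \<in> GL n. \<exists>f\<in>F. f g \<noteq> 0}"
    and "\<exists>F \<subseteq> matrix_polyfun n. T = {g \<in> GL n. \<exists>f\<in>F. f g \<noteq> 0}"
  then obtain F H where F: "F \<subseteq> matrix_polyfun n" "S = {g \<in> GL n. \<exists>f\<in>F. f g \<noteq> 0}"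
    and H: "H \<subseteq> matrix_polyfun n" "T = {g \<in> GL n. \<exists>f\<in>H. f g \<noteq> 0}"
    by blast
  let ?P = "{(\<lambda>g. f g * h g) | f h. f \<in> F \<and> h \<in> H}"
  have "?P \<subseteq> matrix_polyfun n"
    using F(1) H(1) by (auto intro!: matrix_polyfun.mult)
  moreover have "S \<inter> T = {g \<in> GL n. \<exists>f\<in>?P. f g \<noteq> 0}"
    unfolding F(2) H(2) by fastforce
  ultimately show "\<exists>F \<subseteq> matrix_polyfun n. S \<inter> T = {g \<in> GL n. \<exists>f\<in>F. f g \<noteq> 0}"
    by blast
next
  fix \<K> :: "complex mat set set"
  assume "\<forall>K\<in>\<K>. \<exists>F \<subseteq> matrix_polyfun n. K = {g \<in> GL n. \<exists>f\<in>F. f g \<noteq> 0}"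
  from bchoice[OF this] obtain F where F0:
    "\<forall>K\<in>\<K>. F K \<subseteq> matrix_polyfun n \<and> K = {g \<in> GL n. \<exists>f\<in>F K. f g \<noteq> 0}" ..
  have F: "F K \<subseteq> matrix_polyfun n"
    and mem: "g \<in> K \<longleftrightarrow> g \<in> GL n \<and> (\<exists>f\<in>F K. f g \<noteq> 0)" if "K \<in> \<K>" for K g
  proof -
    show "F K \<subseteq> matrix_polyfun n"
      using F0 that by simp
    from F0 that have "K = {g \<in> GL n. \<exists>f\<in>F K. f g \<noteq> 0}"
      by simp
    from this[THEN arg_cong, of "\<lambda>X. g \<in> X"]
    show "g \<in> K \<longleftrightarrow> g \<in> GL n \<and> (\<exists>f\<in>F K. f g \<noteq> 0)"
      unfolding mem_Collect_eq .
  qed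
  have "(\<Union>K\<in>\<K>. F K) \<subseteq> matrix_polyfun n"
    using F by blast
  moreover have "\<Union>\<K> = {g \<in> GL n. \<exists>f\<in>(\<Union>K\<in>\<K>. F K). f g \<noteq> 0}"
    by (auto simp: mem; blast)
  ultimately show "\<exists>F \<subseteq> matrix_polyfun n. \<Union>\<K> = {g \<in> GL n. \<exists>f\<in>F. f g \<noteq> 0}"
    by blast
qed

lemma openin_GL_zariski:
  "openin (GL_zariski n) U \<longleftrightarrow> (\<exists>F \<subseteq> matrix_polyfun n. U = {g \<in> GL n. \<exists>f\<in>F. f g \<noteq> 0})"
  unfolding GL_zariski_def topology_inverse'[OF istopology_GL_zariski] ..

lemma istopology_Fl_zariski:
  "istopology (\<lambda>U. U \<subseteq> Fl n \<and> openin (GL_zariski n) {g \<in> GL n. flag_of n g \<in> U})"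
  unfolding istopology_def
proof (intro conjI allI impI)
  fix S T
  assume S: "S \<subseteq> Fl n \<and> openin (GL_zariski n) {g \<in> GL n. flag_of n g \<in> S}"
    and T: "T \<subseteq> Fl n \<and> openin (GL_zariski n) {g \<in> GL n. flag_of n g \<in> T}"
  have "{g \<in> GL n. flag_of n g \<in> S \<inter> T}
      = {g \<in> GL n. flag_of n g \<in> S} \<inter> {g \<in> GL n. flag_of n g \<in> T}"
    by blast
  then show "openin (GL_zariski n) {g \<in> GL n. flag_of n g \<in> S \<inter> T}"
    using S T by (simp add: openin_Int)
  show "S \<inter> T \<subseteq> Fl n"
    using S by blast
next
  fix \<K>
  assume \<K>: "\<forall>K\<in>\<K>. K \<subseteq> Fl n \<and> openin (GL_zariski n) {g \<in> GL n. flag_of n g \<in> K}"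
  have "{g \<in> GL n. flag_of n g \<in> \<Union>\<K>} = (\<Union>K\<in>\<K>. {g \<in> GL n. flag_of n g \<in> K})"
    by blast
  then show "openin (GL_zariski n) {g \<in> GL n. flag_of n g \<in> \<Union>\<K>}"
    using \<K> by (auto intro!: openin_Union)
  show "\<Union>\<K> \<subseteq> Fl n"
    using \<K> by blast
qed

lemma openin_Fl_zariski:
  "openin (Fl_zariski n) U \<longleftrightarrow>
     U \<subseteq> Fl n \<and> openin (GL_zariski n) {g \<in> GL n. flag_of n g \<in> U}"
  unfolding Fl_zariski_def topology_inverse'[OF istopology_Fl_zariski] ..

lemma topspace_GL_zariski: "topspace (GL_zariski n) = GL n"
proof -
  have "openin (GL_zariski n) (GL n)"
    unfolding openin_GL_zariski
    by (intro exI[of _ "{\<lambda>_. 1}"]) (auto intro: matrix_polyfun.const)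
  moreover have "topspace (GL_zariski n) \<subseteq> GL n"
    using openin_topspace[of "GL_zariski n"] unfolding openin_GL_zariski by blast
  ultimately show ?thesis
    by (simp add: openin_subset subset_antisym)
qed

lemma topspace_Fl_zariski: "topspace (Fl_zariski n) = Fl n"
proof -
  have "{g \<in> GL n. flag_of n g \<in> Fl n} = topspace (GL_zariski n)"
    by (auto simp: Fl_def topspace_GL_zariski)
  then have "openin (Fl_zariski n) (Fl n)"
    by (simp add: openin_Fl_zariski)
  moreover have "topspace (Fl_zariski n) \<subseteq> Fl n"
    using openin_topspace[of "Fl_zariski n"] unfolding openin_Fl_zariski by blast
  ultimately show ?thesis
    by (simp add: openin_subset subset_antisym)
qed


section \<open>The group K and its orbits\<close>

text \<open>\<open>GL p \<times> GL q\<close> embedded block-diagonally in \<open>GL (p + q)\<close>.\<close>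

definition block_K :: "nat \<Rightarrow> nat \<Rightarrow> complex mat set" where
  "block_K p q = {four_block_mat g (0\<^sub>m p q) (0\<^sub>m q p) h | g h. g \<in> GL p \<and> h \<in> GL q}"

definition act_flag :: "complex mat \<Rightarrow> flag \<Rightarrow> flag" where
  "act_flag k V = (\<lambda>i. (\<lambda>x. k *\<^sub>v x) ` V i)"

definition K_orbit :: "nat \<Rightarrow> nat \<Rightarrow> flag \<Rightarrow> flag set" where
  "K_orbit p q V = {act_flag k V | k. k \<in> block_K p q}"


section \<open>Clans\<close>

datatype clan = Clan (arcs: "(nat \<times> nat) set") (plus_nodes: "nat set") (minus_nodes: "nat set")

definition arc_nodes :: "clan \<Rightarrow> nat set" where
  "arc_nodes \<gamma> = fst ` arcs \<gamma> \<union> snd ` arcs \<gamma>"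

definition is_clan :: "nat \<Rightarrow> nat \<Rightarrow> clan \<Rightarrow> bool" where
  "is_clan p q \<gamma> \<longleftrightarrow>
     (\<forall>(i, j) \<in> arcs \<gamma>. 1 \<le> i \<and> i < j \<and> j \<le> p + q) \<and>
     pairwise (\<lambda>(i, j) (k, l). disjnt {i, j} {k, l}) (arcs \<gamma>) \<and>
     plus_nodes \<gamma> \<union> minus_nodes \<gamma> = {1..p+q} - arc_nodes \<gamma> \<and>
     plus_nodes \<gamma> \<inter> minus_nodes \<gamma> = {} \<and>
     int (card (plus_nodes \<gamma>)) - int (card (minus_nodes \<gamma>)) = int p - int q"

text \<open>The permutation attached to a clan. Numbering from left to right means that a node gets
  the number of nodes of its own kind weakly to its left, shifted by \<open>p\<close> for the second kind.\<close>

definition upper_nodes :: "clan \<Rightarrow> nat set" where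
  "upper_nodes \<gamma> = plus_nodes \<gamma> \<union> fst ` arcs \<gamma>"

definition lower_nodes :: "clan \<Rightarrow> nat set" where
  "lower_nodes \<gamma> = minus_nodes \<gamma> \<union> snd ` arcs \<gamma>"

definition clan_perm :: "nat \<Rightarrow> clan \<Rightarrow> nat \<Rightarrow> nat" where
  "clan_perm p \<gamma> i =
     (if i \<in> upper_nodes \<gamma> then card {k \<in> upper_nodes \<gamma>. k \<le> i}
      else if i \<in> lower_nodes \<gamma> then p + card {k \<in> lower_nodes \<gamma>. k \<le> i}
      else i)"

definition basis_vec :: "nat \<Rightarrow> nat \<Rightarrow> complex vec" where
  "basis_vec n k = unit_vec n (k - 1)"

definition clan_vec :: "nat \<Rightarrow> nat \<Rightarrow> clan \<Rightarrow> nat \<Rightarrow> complex vec" where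
  "clan_vec p q \<gamma> i =
     (if \<exists>j. (i, j) \<in> arcs \<gamma>
      then basis_vec (p + q) (clan_perm p \<gamma> i)
             + basis_vec (p + q) (clan_perm p \<gamma> (THE j. (i, j) \<in> arcs \<gamma>))
      else basis_vec (p + q) (clan_perm p \<gamma> i))"

definition clan_flag :: "nat \<Rightarrow> nat \<Rightarrow> clan \<Rightarrow> flag" where
  "clan_flag p q \<gamma> = flag_of (p + q) (mat_of_cols (p + q) (map (clan_vec p q \<gamma>) [1..<p+q+1]))"

definition clan_variety :: "nat \<Rightarrow> nat \<Rightarrow> clan \<Rightarrow> flag set" where
  "clan_variety p q \<gamma> =
     Abstract_Topology.closure_of (Fl_zariski (p + q)) (K_orbit p q (clan_flag p q \<gamma>))"


section \<open>The curve\<close>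

definition curve_mat :: "nat \<Rightarrow> (nat \<Rightarrow> nat) \<Rightarrow> nat \<Rightarrow> nat \<Rightarrow> complex \<Rightarrow> complex mat" where
  "curve_mat n v a b z =
     mat_of_cols n (map (\<lambda>i. basis_vec n (v i) + (if i = a then z else 0) \<cdot>\<^sub>v basis_vec n (v b))
                        [1..<n+1])"

text \<open>This is the T-stable curve joining \<open>V\<close> for \<open>v\<close> (the value at \<open>z = 0\<close>) to \<open>V\<close> for
  \<open>v t\<^sub>a\<^sub>b\<close> (the limit point at infinity).\<close>

definition T_curve :: "nat \<Rightarrow> (nat \<Rightarrow> nat) \<Rightarrow> nat \<Rightarrow> nat \<Rightarrow> flag set" where
  "T_curve n v a b =
     Abstract_Topology.closure_of (Fl_zariski n) (range (\<lambda>z. flag_of n (curve_mat n v a b z)))"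

end

theory Submission
  imports Defs "Jordan_Normal_Form.Column_Operations"
begin

text \<open>Left multiplication by the permutation matrix \<open>P\<close> of \<open>v\<close> reduces everything to matrices \<open>Z\<close> such
  that the flag of \<open>P Z\<close> lies in the closed, K-stable set \<open>Y\<^sub>\<gamma>\<close>: the point \<open>z\<close> of the curve is
  \<open>1 + z E\<^sub>b\<^sub>a\<close>, the base point of the orbit is \<open>1 + \<Sum> E\<^sub>j\<^sub>i\<close> over the arcs, and the conjugate of K acts
  on the left, upper triangular matrices on the right. If the labels at \<open>a\<close> and \<open>b\<close> are on the same
  side, \<open>1 + z E\<^sub>b\<^sub>a\<close> itself belongs to that conjugate. If an arc \<open>(i, j)\<close> covers \<open>a < b\<close>, all other arcs are
  scaled to zero by the torus and the remaining one is slid to \<open>(a, b)\<close>.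

  Conversely, two rank conditions hold on \<open>Y\<^sub>\<gamma>\<close>. With \<open>\<pi>\<close> the projection to the first \<open>p\<close> coordinates,
  \<open>dim \<pi>(V\<^sub>a)\<close> is at most the number of nodes up to \<open>a\<close> that are \<open>+\<close> or left endpoints, which excludes
  \<open>v(b) \<le> p < v(a)\<close>; and \<open>\<pi>(V\<^sub>a) \<subseteq> V\<^bsub>b-1\<^esub>\<close> if no arc covers \<open>a < b\<close>, which excludes the other case.\<close>

section \<open>Flags and matrices\<close>

lemma GL_iff: "g \<in> GL n \<longleftrightarrow> g \<in> carrier_mat n n \<and> det g \<noteq> 0"
proof
  assume "g \<in> GL n"
  then obtain h where g: "g \<in> carrier_mat n n" and gh: "g * h = 1\<^sub>m n" and hg: "h * g = 1\<^sub>m (dim_row h)"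
    by (auto simp: GL_def invertible_mat_def inverts_mat_def)
  from arg_cong[OF gh, of dim_col] arg_cong[OF hg, of dim_col] g
  have h: "h \<in> carrier_mat n n" by auto
  from det_mult[OF g h] gh have "det g \<noteq> 0" by auto
  with g show "g \<in> carrier_mat n n \<and> det g \<noteq> 0" by simp
next
  assume g: "g \<in> carrier_mat n n \<and> det g \<noteq> 0"
  then obtain h where "h \<in> carrier_mat n n" "g * h = 1\<^sub>m n" "h * g = 1\<^sub>m n"
    using det_non_zero_imp_unit[of g n "()"]
    by (auto simp: Units_def ring_mat_def)
  with g show "g \<in> GL n"
    by (auto simp: GL_def invertible_mat_def inverts_mat_def square_mat.simps)
qed

lemma GL_carrier: "g \<in> GL n \<Longrightarrow> g \<in> carrier_mat n n"
  by (simp add: GL_iff)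

lemma GL_inverse:
  assumes "g \<in> GL n"
  obtains h where "h \<in> GL n" "g * h = 1\<^sub>m n" "h * g = 1\<^sub>m n"
proof -
  have g: "g \<in> carrier_mat n n" "det g \<noteq> 0" using assms by (auto simp: GL_iff)
  obtain h where h: "h \<in> carrier_mat n n" "g * h = 1\<^sub>m n" "h * g = 1\<^sub>m n"
    using det_non_zero_imp_unit[OF g, of "()"]
    by (auto simp: Units_def ring_mat_def)
  with det_mult[OF h(1) g(1)] have "h \<in> GL n" by (auto simp: GL_iff)
  with h that show thesis by blast
qed

lemma GL_mult: "g \<in> GL n \<Longrightarrow> h \<in> GL n \<Longrightarrow> g * h \<in> GL n"
  by (auto simp: GL_iff det_mult[of _ n])

text \<open>The standard coordinate flag, of which \<open>flag_of n g\<close> is the image under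
  \<open>g\<close>. It is the whole space once \<open>i\<close> reaches \<open>n\<close>.\<close>

definition coord_space :: "nat \<Rightarrow> nat \<Rightarrow> complex vec set" where
  "coord_space n i = {c \<in> carrier_vec n. \<forall>k<n. i \<le> k \<longrightarrow> c $ k = 0}"

text \<open>Combining the first \<open>i\<close> columns with coefficients \<open>c\<close> is
  applying \<open>g\<close> to \<open>c\<close> padded by zeros. Lists of columns are used so that
  coefficients belong to positions.\<close>

lemma flag_of_eq:
  assumes g: "g \<in> carrier_mat n n"
  shows "flag_of n g i = (\<lambda>c. g *\<^sub>v c) ` coord_space n i"
proof -
  interpret vec_space "TYPE(complex)" n .
  have cols: "set (take i (cols g)) \<subseteq> carrier_vec n"
    using g cols_dim[of g] set_take_subset[of i "cols g"] by auto
  have *: "lincomb_list c (take i (cols g)) = g *\<^sub>v vec n (\<lambda>k. if k < i then c k else 0)" for c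
  proof -
    have "lincomb_list c (take i (cols g)) =
        mat_of_cols n (take i (cols g)) *\<^sub>v vec (length (take i (cols g))) c"
      using cols by (intro lincomb_list_as_mat_mult) auto
    also have "\<dots> = g *\<^sub>v vec n (\<lambda>k. if k < i then c k else 0)"
    proof (rule eq_vecI)
      fix r assume "r < dim_vec (g *\<^sub>v vec n (\<lambda>k. if k < i then c k else 0))"
      then have r: "r < n" using g by auto
      have "(mat_of_cols n (take i (cols g)) *\<^sub>v vec (length (take i (cols g))) c) $ r
          = (\<Sum>k = 0..<min n i. g $$ (r, k) * c k)"
        using r g by (auto simp: scalar_prod_def mat_of_cols_index intro!: sum.cong)
      also have "\<dots> = (\<Sum>k = 0..<n. g $$ (r, k) * (if k < i then c k else 0))"
        by (rule sum.mono_neutral_cong_left) auto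
      also have "\<dots> = (g *\<^sub>v vec n (\<lambda>k. if k < i then c k else 0)) $ r"
        using r g by (auto simp: scalar_prod_def)
      finally show "(mat_of_cols n (take i (cols g)) *\<^sub>v vec (length (take i (cols g))) c) $ r
          = (g *\<^sub>v vec n (\<lambda>k. if k < i then c k else 0)) $ r" .
    qed (use g in auto)
    finally show ?thesis .
  qed
  have "flag_of n g i = span_list (take i (cols g))"
    unfolding flag_of_def using span_list_as_span[OF cols] by simp
  also have "\<dots> = (\<lambda>c. g *\<^sub>v c) ` range (\<lambda>c. vec n (\<lambda>k. if k < i then c k else 0))"
    unfolding span_list_def * by auto
  also have "range (\<lambda>c. vec n (\<lambda>k. if k < i then c k else 0)) = coord_space n i"
  proof safe
    fix c assume c: "c \<in> coord_space n i"
    then have "c = vec n (\<lambda>k. if k < i then c $ k else 0)"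
      by (intro eq_vecI) (auto simp: coord_space_def)
    then show "c \<in> range (\<lambda>c. vec n (\<lambda>k. if k < i then c k else 0))" by blast
  qed (auto simp: coord_space_def)
  finally show ?thesis .
qed

lemma act_flag_flag_of:
  assumes "k \<in> carrier_mat n n" "g \<in> carrier_mat n n"
  shows "act_flag k (flag_of n g) = flag_of n (k * g)"
proof
  fix i
  have "k * g \<in> carrier_mat n n" using assms by simp
  then show "act_flag k (flag_of n g) i = flag_of n (k * g) i"
    using assms
    by (auto simp: act_flag_def flag_of_eq image_image coord_space_def assoc_mult_mat_vec[of _ n n _ n]
        intro!: image_cong)
qed

lemma upper_triangular_mult_coord_space:
  assumes b: "b \<in> carrier_mat n n" "upper_triangular b" and c: "c \<in> coord_space n i"
  shows "b *\<^sub>v c \<in> coord_space n i"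
proof -
  have "(b *\<^sub>v c) $ k = 0" if "k < n" "i \<le> k" for k
  proof -
    have "b $$ (k, l) * c $ l = 0" if "l < n" for l
    proof (cases "l < k")
      case True
      then show ?thesis using b \<open>k < n\<close> by (auto simp: upper_triangular_def)
    next
      case False
      then show ?thesis using c \<open>i \<le> k\<close> that by (auto simp: coord_space_def)
    qed
    then have "(\<Sum>l = 0..<n. b $$ (k, l) * c $ l) = 0" by (intro sum.neutral) auto
    moreover have "(b *\<^sub>v c) $ k = (\<Sum>l = 0..<n. b $$ (k, l) * c $ l)"
      using b c that by (auto simp: scalar_prod_def coord_space_def)
    ultimately show ?thesis by simp
  qed
  then show ?thesis using b c by (auto simp: coord_space_def)
qed

text \<open>Both \<open>b\<close> and \<open>b'\<close> preserve every coordinate space, so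
  \<open>b\<close> maps each of them onto itself; \<open>b'\<close> supplies the preimages.\<close>

lemma flag_of_mult_upper_triangular:
  assumes g: "g \<in> carrier_mat n n"
    and b: "b \<in> carrier_mat n n" "upper_triangular b"
    and b': "b' \<in> carrier_mat n n" "upper_triangular b'"
    and inv: "b * b' = 1\<^sub>m n"
  shows "flag_of n (g * b) = flag_of n g"
proof
  fix i
  have gb: "g * b \<in> carrier_mat n n" using g b by simp
  have "flag_of n (g * b) i = (\<lambda>c. g *\<^sub>v c) ` (\<lambda>c. b *\<^sub>v c) ` coord_space n i"
    unfolding flag_of_eq[OF gb] image_image
    using g b by (intro image_cong) (auto simp: coord_space_def)
  also have "(\<lambda>c. b *\<^sub>v c) ` coord_space n i = coord_space n i"
  proof safe
    fix c assume c: "c \<in> coord_space n i"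
    then have "c = b *\<^sub>v (b' *\<^sub>v c)"
      using b b' inv by (subst assoc_mult_mat_vec[symmetric, of _ n n _ n]) (auto simp: coord_space_def)
    then show "c \<in> (\<lambda>c. b *\<^sub>v c) ` coord_space n i"
      using upper_triangular_mult_coord_space[OF b' c] by blast
  qed (rule upper_triangular_mult_coord_space[OF b])
  finally show "flag_of n (g * b) i = flag_of n g i" by (simp add: flag_of_eq[OF g])
qed

text \<open>Column \<open>j\<close> of \<open>h\<close> lies in space \<open>Suc j\<close> of the
  flag of \<open>g\<close>, so it is \<open>g\<close> applied to some \<open>c\<close> supported on
  the first \<open>Suc j\<close> coordinates; this \<open>c\<close> is column \<open>j\<close> of
  \<open>g' * h\<close>.\<close>

lemma flag_of_eq_imp_upper_triangular:
  assumes g: "g \<in> carrier_mat n n" and h: "h \<in> carrier_mat n n"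
    and gg': "g * g' = 1\<^sub>m n" "g' * g = 1\<^sub>m n" "g' \<in> carrier_mat n n"
    and eq: "flag_of n h = flag_of n g"
  shows "upper_triangular (g' * h)"
proof (rule upper_triangularI)
  fix j i assume "j < i" "i < dim_row (g' * h)"
  then have ij: "j < i" "i < n" "j < n" using gg' by auto
  have "unit_vec n j \<in> coord_space n (Suc j)" by (auto simp: coord_space_def)
  then have "h *\<^sub>v unit_vec n j \<in> flag_of n g (Suc j)"
    unfolding eq[symmetric] flag_of_eq[OF h] by blast
  then obtain c where c: "c \<in> coord_space n (Suc j)" "h *\<^sub>v unit_vec n j = g *\<^sub>v c"
    unfolding flag_of_eq[OF g] by auto
  have cc: "c \<in> carrier_vec n" using c by (simp add: coord_space_def)
  have "(g' * h) *\<^sub>v unit_vec n j = g' *\<^sub>v (g *\<^sub>v c)"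
    using gg' h c by simp
  also have "\<dots> = c"
    using assoc_mult_mat_vec[OF gg'(3) g cc] gg' cc by simp
  finally have eqc: "(g' * h) *\<^sub>v unit_vec n j = c" .
  have "(g' * h) $$ (i, j) = ((g' * h) *\<^sub>v unit_vec n j) $ i"
    using ij mult_carrier_mat[OF gg'(3) h] by (subst index_mult_mat_vec) (auto simp del: index_mult_mat)
  then show "(g' * h) $$ (i, j) = 0"
    using c ij unfolding eqc by (auto simp: coord_space_def)
qed

section \<open>Closed sets of flags\<close>

text \<open>Agreement is asked only on \<open>n \<times> n\<close> matrices: the formulas for
  products and determinants hold only there, while members of \<open>matrix_polyfun\<close> are
  functions on matrices of all sizes.\<close>

definition polyfun_on :: "nat \<Rightarrow> (complex mat \<Rightarrow> complex) \<Rightarrow> bool" where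
  "polyfun_on n f \<longleftrightarrow> (\<exists>h\<in>matrix_polyfun n. \<forall>g\<in>carrier_mat n n. h g = f g)"

lemma polyfun_on_matrix_polyfun: "f \<in> matrix_polyfun n \<Longrightarrow> polyfun_on n f"
  by (auto simp: polyfun_on_def)

lemma polyfun_on_const: "polyfun_on n (\<lambda>_. c)"
  by (rule polyfun_on_matrix_polyfun) (rule matrix_polyfun.const)

lemma polyfun_on_entry: "i < n \<Longrightarrow> j < n \<Longrightarrow> polyfun_on n (\<lambda>g. g $$ (i, j))"
  by (rule polyfun_on_matrix_polyfun) (rule matrix_polyfun.entry)

lemma polyfun_on_add: "polyfun_on n f \<Longrightarrow> polyfun_on n h \<Longrightarrow> polyfun_on n (\<lambda>g. f g + h g)"
  unfolding polyfun_on_def by (metis (no_types, lifting) matrix_polyfun.add)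

lemma polyfun_on_mult: "polyfun_on n f \<Longrightarrow> polyfun_on n h \<Longrightarrow> polyfun_on n (\<lambda>g. f g * h g)"
  unfolding polyfun_on_def by (metis (no_types, lifting) matrix_polyfun.mult)

lemma polyfun_on_sum: "(\<And>x. x \<in> A \<Longrightarrow> polyfun_on n (f x)) \<Longrightarrow> polyfun_on n (\<lambda>g. \<Sum>x\<in>A. f x g)"
  by (induction A rule: infinite_finite_induct)
    (auto intro: polyfun_on_add polyfun_on_const)

lemma polyfun_on_prod: "(\<And>x. x \<in> A \<Longrightarrow> polyfun_on n (f x)) \<Longrightarrow> polyfun_on n (\<lambda>g. \<Prod>x\<in>A. f x g)"
  by (induction A rule: infinite_finite_induct)
    (auto intro: polyfun_on_mult polyfun_on_const)

lemma polyfun_on_cong: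
  assumes "polyfun_on n f" "\<And>g. g \<in> carrier_mat n n \<Longrightarrow> f g = h g"
  shows "polyfun_on n h"
  using assms by (auto simp: polyfun_on_def)

text \<open>Substitution of polynomials, by induction on the representative \<open>h\<close>. The
  values of \<open>N\<close> stay among the \<open>n \<times> n\<close> matrices, where
  \<open>h\<close> and \<open>f\<close> agree.\<close>

lemma polyfun_on_compose:
  assumes f: "polyfun_on n f"
    and N: "\<And>g. g \<in> carrier_mat n n \<Longrightarrow> N g \<in> carrier_mat n n"
    and entries: "\<And>i j. i < n \<Longrightarrow> j < n \<Longrightarrow> polyfun_on n (\<lambda>g. N g $$ (i, j))"
  shows "polyfun_on n (\<lambda>g. f (N g))"
proof -
  from f obtain h where h: "h \<in> matrix_polyfun n" "\<And>g. g \<in> carrier_mat n n \<Longrightarrow> h g = f g"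
    by (auto simp: polyfun_on_def)
  from h(1) have "polyfun_on n (\<lambda>g. h (N g))"
    by induction (auto intro: polyfun_on_const polyfun_on_add polyfun_on_mult entries)
  then show ?thesis by (rule polyfun_on_cong) (simp add: h N)
qed

lemma polyfun_on_det: "polyfun_on n det"
proof -
  have "polyfun_on n (\<lambda>g. \<Sum>p\<in>{p. p permutes {0..<n}}. signof p * (\<Prod>i = 0..<n. g $$ (i, p i)))"
    by (intro polyfun_on_sum polyfun_on_mult polyfun_on_const polyfun_on_prod polyfun_on_entry)
      (auto dest: permutes_in_image)
  then show ?thesis
    by (rule polyfun_on_cong) (simp add: det_def')
qed

lemma polyfun_on_mult_entry:
  assumes "A \<in> carrier_mat n n" "i < n" "j < n"
  shows "polyfun_on n (\<lambda>g. (A * g) $$ (i, j))" "polyfun_on n (\<lambda>g. (g * A) $$ (i, j))"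
proof -
  have "polyfun_on n (\<lambda>g. \<Sum>k = 0..<n. A $$ (i, k) * g $$ (k, j))"
    using assms by (intro polyfun_on_sum polyfun_on_mult polyfun_on_const polyfun_on_entry) auto
  then show "polyfun_on n (\<lambda>g. (A * g) $$ (i, j))"
    by (rule polyfun_on_cong) (use assms in \<open>auto simp: scalar_prod_def\<close>)
  have "polyfun_on n (\<lambda>g. \<Sum>k = 0..<n. g $$ (i, k) * A $$ (k, j))"
    using assms by (intro polyfun_on_sum polyfun_on_mult polyfun_on_const polyfun_on_entry) auto
  then show "polyfun_on n (\<lambda>g. (g * A) $$ (i, j))"
    by (rule polyfun_on_cong) (use assms in \<open>auto simp: scalar_prod_def\<close>)
qed

lemma matrix_polyfun_continuous:
  assumes "f \<in> matrix_polyfun n"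
    and "\<And>i j. i < n \<Longrightarrow> j < n \<Longrightarrow> isCont (\<lambda>t::complex. G t $$ (i, j)) x"
  shows "isCont (\<lambda>t. f (G t)) x"
  using assms by (induction) (auto intro!: continuous_intros)

section \<open>From polynomial functions on matrices to closures of sets of flags\<close>

lemma open_GL_zariski_polyfun_on:
  assumes "\<And>f. f \<in> F \<Longrightarrow> polyfun_on n f"
  shows "openin (GL_zariski n) {g \<in> GL n. \<exists>f\<in>F. f g \<noteq> 0}"
proof -
  let ?H = "{h \<in> matrix_polyfun n. \<exists>f\<in>F. \<forall>g\<in>carrier_mat n n. h g = f g}"
  have "{g \<in> GL n. \<exists>f\<in>F. f g \<noteq> 0} = {g \<in> GL n. \<exists>h\<in>?H. h g \<noteq> 0}"
  proof (intro Collect_cong conj_cong refl iffI)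
    fix g assume g: "g \<in> GL n" and "\<exists>f\<in>F. f g \<noteq> 0"
    then obtain f where f: "f \<in> F" "f g \<noteq> 0" by blast
    with assms obtain h where h: "h \<in> matrix_polyfun n" "\<forall>g\<in>carrier_mat n n. h g = f g"
      by (auto simp: polyfun_on_def)
    then have "h \<in> ?H" using f(1) by blast
    moreover have "h g \<noteq> 0" using h(2) f(2) GL_carrier[OF g] by simp
    ultimately show "\<exists>h\<in>?H. h g \<noteq> 0" by blast
  next
    fix g assume g: "g \<in> GL n" and "\<exists>h\<in>?H. h g \<noteq> 0"
    then obtain h f where "h g \<noteq> 0" "f \<in> F" "\<forall>g\<in>carrier_mat n n. h g = f g" by blast
    with GL_carrier[OF g] show "\<exists>f\<in>F. f g \<noteq> 0" by auto
  qed
  then show ?thesis unfolding openin_GL_zariski by (intro exI[of _ ?H]) auto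
qed

text \<open>The nonvanishing set of \<open>f\<close> need not be a union of cosets of the triangular
  group, so it is saturated first: the union of its translates by invertible triangular matrices is
  open and is the preimage of \<open>U\<close>. This is the openness of the quotient map.\<close>

lemma polyfun_vanishes_on_closure:
  assumes f: "polyfun_on n f"
    and g0: "g0 \<in> GL n" "flag_of n g0 \<in> Abstract_Topology.closure_of (Fl_zariski n) S"
    and vanish: "\<And>g. g \<in> GL n \<Longrightarrow> flag_of n g \<in> S \<Longrightarrow> f g = 0"
  shows "f g0 = 0"
proof (rule ccontr)
  assume nz: "f g0 \<noteq> 0"
  define U where "U = flag_of n ` {g \<in> GL n. f g \<noteq> 0}"
  define B :: "complex mat set" where "B = {b \<in> carrier_mat n n. upper_triangular b \<and>
      (\<exists>b'\<in>carrier_mat n n. upper_triangular b' \<and> b * b' = 1\<^sub>m n)}"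
  have "{g \<in> GL n. flag_of n g \<in> U} = {g \<in> GL n. \<exists>h\<in>(\<lambda>b g. f (g * b)) ` B. h g \<noteq> 0}"
  proof (intro Collect_cong conj_cong refl iffI)
    fix g assume g: "g \<in> GL n" and "flag_of n g \<in> U"
    then obtain h where h: "h \<in> GL n" "f h \<noteq> 0" "flag_of n h = flag_of n g"
      by (auto simp: U_def)
    obtain g' where g': "g' \<in> GL n" "g * g' = 1\<^sub>m n" "g' * g = 1\<^sub>m n"
      using GL_inverse[OF g] .
    obtain h' where h': "h' \<in> GL n" "h * h' = 1\<^sub>m n" "h' * h = 1\<^sub>m n"
      using GL_inverse[OF h(1)] .
    note c = g[THEN GL_carrier] h(1)[THEN GL_carrier] g'(1)[THEN GL_carrier] h'(1)[THEN GL_carrier]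
    have "upper_triangular (g' * h)" "upper_triangular (h' * g)"
      using flag_of_eq_imp_upper_triangular[of g n h g'] flag_of_eq_imp_upper_triangular[of h n g h'] c g' h' h
      by auto
    moreover have "(g' * h) * (h' * g) = 1\<^sub>m n"
    proof -
      have "(g' * h) * (h' * g) = g' * (h * (h' * g))"
        by (rule assoc_mult_mat[OF c(3,2) mult_carrier_mat[OF c(4,1)]])
      also have "h * (h' * g) = (h * h') * g"
        by (rule assoc_mult_mat[OF c(2,4,1), symmetric])
      also have "\<dots> = g" unfolding h'(2) by (rule left_mult_one_mat[OF c(1)])
      finally show ?thesis unfolding g'(3) .
    qed
    ultimately have "g' * h \<in> B"
      unfolding B_def using mult_carrier_mat[OF c(3,2)] mult_carrier_mat[OF c(4,1)] by blast
    moreover have "g * (g' * h) = h"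
      unfolding assoc_mult_mat[OF c(1,3,2), symmetric] g'(2) left_mult_one_mat[OF c(2)] ..
    ultimately show "\<exists>h\<in>(\<lambda>b g. f (g * b)) ` B. h g \<noteq> 0"
      using h(2) by (intro bexI[of _ "\<lambda>g. f (g * (g' * h))"]) auto
  next
    fix g assume g: "g \<in> GL n" and "\<exists>h\<in>(\<lambda>b g. f (g * b)) ` B. h g \<noteq> 0"
    then obtain b b' where b: "b \<in> carrier_mat n n" "upper_triangular b" "b' \<in> carrier_mat n n"
      "upper_triangular b'" "b * b' = 1\<^sub>m n" "f (g * b) \<noteq> 0"
      by (auto simp: B_def)
    have "flag_of n (g * b) = flag_of n g"
      using b g GL_carrier by (intro flag_of_mult_upper_triangular) auto
    moreover have "b \<in> GL n" using b det_mult[OF b(1,3)] by (auto simp: GL_iff)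
    then have "g * b \<in> GL n" by (rule GL_mult[OF g])
    ultimately show "flag_of n g \<in> U" using b(6) unfolding U_def by (intro image_eqI[of _ _ "g * b"]) auto
  qed
  also have "openin (GL_zariski n) \<dots>"
  proof (rule open_GL_zariski_polyfun_on)
    fix h assume "h \<in> (\<lambda>b g. f (g * b)) ` B"
    then show "polyfun_on n h"
      by (auto simp: B_def intro!: polyfun_on_compose[OF f] polyfun_on_mult_entry(2))
  qed
  finally have "openin (Fl_zariski n) U"
    unfolding openin_Fl_zariski by (auto simp: U_def Fl_def)
  moreover have "flag_of n g0 \<in> U" using nz g0 by (auto simp: U_def)
  ultimately obtain V where "V \<in> S" "V \<in> U"
    using g0(2) unfolding in_closure_of by blast
  then show False using vanish by (auto simp: U_def)
qed

text \<open>Left multiplication by \<open>k\<close> has polynomial entries, so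
  \<open>act_flag k\<close> is continuous, and a continuous map preserving \<open>S\<close>
  preserves its closure.\<close>

lemma act_flag_closure_of:
  assumes k: "k \<in> GL n" and S: "\<And>V. V \<in> S \<Longrightarrow> act_flag k V \<in> S"
    and V: "V \<in> Fl_zariski n closure_of S"
  shows "act_flag k V \<in> Fl_zariski n closure_of S"
proof -
  have kc: "k \<in> carrier_mat n n" using k by (rule GL_carrier)
  have mem: "act_flag k W \<in> Fl n" if "W \<in> Fl n" for W
    using that k kc GL_carrier GL_mult by (auto simp: Fl_def act_flag_flag_of)
  have "continuous_map (Fl_zariski n) (Fl_zariski n) (act_flag k)"
    unfolding continuous_map_def topspace_Fl_zariski
  proof (intro conjI allI impI)
    fix U assume U: "openin (Fl_zariski n) U"
    then obtain F where F: "F \<subseteq> matrix_polyfun n" "{g \<in> GL n. flag_of n g \<in> U} = {g \<in> GL n. \<exists>f\<in>F. f g \<noteq> 0}"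
      unfolding openin_Fl_zariski openin_GL_zariski by blast
    have "{g \<in> GL n. flag_of n g \<in> {W \<in> Fl n. act_flag k W \<in> U}}
        = {g \<in> GL n. flag_of n (k * g) \<in> U}"
      by (intro Collect_cong conj_cong refl)
        (simp add: Fl_def kc GL_carrier act_flag_flag_of[symmetric])
    also have "\<dots> = {g \<in> GL n. \<exists>h\<in>(\<lambda>f g. f (k * g)) ` F. h g \<noteq> 0}"
    proof (intro Collect_cong conj_cong refl)
      fix g assume "g \<in> GL n"
      then have "k * g \<in> GL n" using k by (rule GL_mult[rotated])
      then show "flag_of n (k * g) \<in> U \<longleftrightarrow> (\<exists>h\<in>(\<lambda>f g. f (k * g)) ` F. h g \<noteq> 0)"
        using F(2)[THEN eqset_imp_iff, of "k * g"] by simp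
    qed
    also have "openin (GL_zariski n) \<dots>"
    proof (rule open_GL_zariski_polyfun_on)
      fix h assume "h \<in> (\<lambda>f g. f (k * g)) ` F"
      then obtain f where f: "f \<in> F" "h = (\<lambda>g. f (k * g))" by blast
      have "polyfun_on n f" using f(1) F(1) by (blast intro: polyfun_on_matrix_polyfun)
      then show "polyfun_on n h"
        unfolding f(2)
        by (rule polyfun_on_compose) (use kc polyfun_on_mult_entry(1)[OF kc] in simp_all)
    qed
    finally show "openin (Fl_zariski n) {W \<in> Fl n. act_flag k W \<in> U}"
      unfolding openin_Fl_zariski by auto
  qed (use mem in auto)
  then have "act_flag k ` (Fl_zariski n closure_of S) \<subseteq> Fl_zariski n closure_of (act_flag k ` S)"
    by (rule continuous_map_image_closure_subset)
  also have "\<dots> \<subseteq> Fl_zariski n closure_of S"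
    using S by (intro closure_of_mono) auto
  finally show ?thesis using V by blast
qed

text \<open>Polynomial functions are continuous for the classical topology, so a Zariski closed set of
  flags is also closed under classical limits.\<close>

lemma closedin_Fl_zariski_limit:
  fixes G :: "complex \<Rightarrow> complex mat"
  assumes Y: "closedin (Fl_zariski n) Y" and G: "\<And>t. G t \<in> GL n"
    and cont: "\<And>i j. i < n \<Longrightarrow> j < n \<Longrightarrow> isCont (\<lambda>t. G t $$ (i, j)) 0"
    and mem: "\<And>t. t \<noteq> 0 \<Longrightarrow> flag_of n (G t) \<in> Y"
  shows "flag_of n (G 0) \<in> Y"
proof (rule ccontr)
  assume "flag_of n (G 0) \<notin> Y"
  moreover have "openin (Fl_zariski n) (Fl n - Y)"
    using Y by (metis closedin_def topspace_Fl_zariski)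
  then obtain F where F: "F \<subseteq> matrix_polyfun n"
    "{g \<in> GL n. flag_of n g \<in> Fl n - Y} = {g \<in> GL n. \<exists>f\<in>F. f g \<noteq> 0}"
    unfolding openin_Fl_zariski openin_GL_zariski by blast
  have iff: "flag_of n (G t) \<notin> Y \<longleftrightarrow> (\<exists>f\<in>F. f (G t) \<noteq> 0)" for t
    using F(2)[THEN eqset_imp_iff, of "G t"] G[of t] by (auto simp: Fl_def)
  ultimately obtain f where f: "f \<in> F" "f (G 0) \<noteq> 0" by blast
  with F(1) have "isCont (\<lambda>t. f (G t)) 0"
    by (auto intro: matrix_polyfun_continuous cont)
  then have "eventually (\<lambda>t. f (G t) \<noteq> 0) (at 0)"
    using f(2) by (auto simp: isCont_def intro: tendsto_imp_eventually_ne)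
  \<comment> \<open>For \<open>t \<noteq> 0\<close> the flag lies in \<open>Y\<close>, so
    \<open>f\<close> vanishes there, while continuity keeps \<open>f\<close> nonzero near 0;
    punctured neighbourhoods of 0 are not empty.\<close>
  then have "eventually (\<lambda>t. False) (at (0::complex))"
    by (rule eventually_mono[OF eventually_conj[OF _ eventually_neq_at_within[of 0]]])
      (use mem iff f(1) in blast)
  then show False by simp
qed

section \<open>Permutation matrices and the group K\<close>

definition perm_mat :: "nat \<Rightarrow> (nat \<Rightarrow> nat) \<Rightarrow> complex mat" where
  "perm_mat n w = mat n n (\<lambda>(r, c). if r = w c then 1 else 0)"

lemma perm_mat_carrier [simp]: "perm_mat n w \<in> carrier_mat n n"
  by (simp add: perm_mat_def)

lemma perm_mat_dim [simp]: "dim_row (perm_mat n w) = n" "dim_col (perm_mat n w) = n"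
  by (simp_all add: perm_mat_def)

lemma perm_mat_index: "r < n \<Longrightarrow> c < n \<Longrightarrow> perm_mat n w $$ (r, c) = (if r = w c then 1 else 0)"
  by (simp add: perm_mat_def)

context
  fixes w :: "nat \<Rightarrow> nat" and n :: nat
  assumes bij: "bij_betw w {..<n} {..<n}"
begin

lemma perm_lt: "k < n \<Longrightarrow> w k < n"
  using bij by (auto simp: bij_betw_def)

lemma inv_perm_lt: "r < n \<Longrightarrow> inv_into {..<n} w r < n"
  using bij inv_into_into[of r w "{..<n}"] by (auto simp: bij_betw_def)

lemma perm_eq_iff: "r < n \<Longrightarrow> k < n \<Longrightarrow> r = w k \<longleftrightarrow> inv_into {..<n} w r = k"
  using bij by (auto simp: bij_betw_inv_into_left bij_betw_inv_into_right)

lemma perm_mat_mult: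
  assumes "A \<in> carrier_mat n n" "r < n" "c < n"
  shows "(perm_mat n w * A) $$ (r, c) = A $$ (inv_into {..<n} w r, c)"
proof -
  have "(perm_mat n w * A) $$ (r, c) = (\<Sum>k = 0..<n. perm_mat n w $$ (r, k) * A $$ (k, c))"
    using assms by (auto simp: scalar_prod_def)
  also have "\<dots> = (\<Sum>k = 0..<n. (if inv_into {..<n} w r = k then A $$ (k, c) else 0))"
    using assms by (intro sum.cong refl) (simp add: perm_mat_index perm_eq_iff)
  also have "\<dots> = A $$ (inv_into {..<n} w r, c)"
    using inv_perm_lt[OF assms(2)] by simp
  finally show ?thesis .
qed

lemma mult_perm_mat:
  assumes "A \<in> carrier_mat n n" "r < n" "c < n"
  shows "(A * perm_mat n w) $$ (r, c) = A $$ (r, w c)"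
proof -
  have "(A * perm_mat n w) $$ (r, c) = (\<Sum>k = 0..<n. A $$ (r, k) * perm_mat n w $$ (k, c))"
    using assms by (auto simp: scalar_prod_def)
  also have "\<dots> = (\<Sum>k = 0..<n. (if w c = k then A $$ (r, k) else 0))"
    using assms by (intro sum.cong refl) (auto simp: perm_mat_index)
  also have "\<dots> = A $$ (r, w c)"
    using perm_lt[OF assms(3)] by simp
  finally show ?thesis .
qed

lemma perm_mat_GL: "perm_mat n w \<in> GL n"
proof -
  \<comment> \<open>The transpose is a left inverse.\<close>
  let ?Q = "mat n n (\<lambda>(r, c). if w r = c then 1 else 0) :: complex mat"
  have "?Q * perm_mat n w = 1\<^sub>m n"
  proof (rule eq_matI)
    fix r c assume "r < dim_row (1\<^sub>m n)" "c < dim_col (1\<^sub>m n)"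
    then have "r < n" "c < n" by auto
    then show "(?Q * perm_mat n w) $$ (r, c) = 1\<^sub>m n $$ (r, c)"
      using perm_lt perm_eq_iff[of "w r" c] perm_eq_iff[of "w r" r] by (subst mult_perm_mat) auto
  qed auto
  moreover have "?Q \<in> carrier_mat n n" by simp
  ultimately show ?thesis
    using det_mult[of ?Q n "perm_mat n w"] by (auto simp: GL_iff)
qed

end

section \<open>The block-diagonal group and its conjugate under a permutation matrix\<close>

lemma block_K_GL: "k \<in> block_K p q \<Longrightarrow> k \<in> GL (p + q)"
  by (auto simp: block_K_def GL_iff det_four_block_mat_lower_left_zero[of _ p _ q])

lemma block_K_mult: "k \<in> block_K p q \<Longrightarrow> l \<in> block_K p q \<Longrightarrow> k * l \<in> block_K p q"
proof -
  assume "k \<in> block_K p q" "l \<in> block_K p q"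
  then obtain g h g' h' where gh: "g \<in> GL p" "h \<in> GL q" "k = four_block_mat g (0\<^sub>m p q) (0\<^sub>m q p) h"
    and gh': "g' \<in> GL p" "h' \<in> GL q" "l = four_block_mat g' (0\<^sub>m p q) (0\<^sub>m q p) h'"
    by (auto simp: block_K_def)
  note c = gh(1,2)[THEN GL_carrier] gh'(1,2)[THEN GL_carrier]
  have "k * l = four_block_mat (g * g') (0\<^sub>m p q) (0\<^sub>m q p) (h * h')"
    unfolding gh(3) gh'(3) using c
    by (subst mult_four_block_mat[of _ p p _ q _ q _ _ p _ q]) auto
  then show ?thesis
    using GL_mult[OF gh(1) gh'(1)] GL_mult[OF gh(2) gh'(2)] by (auto simp: block_K_def)
qed

lemma one_block_K: "1\<^sub>m (p + q) \<in> block_K p q"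
proof -
  have "1\<^sub>m (p + q) = four_block_mat (1\<^sub>m p) (0\<^sub>m p q) (0\<^sub>m q p) (1\<^sub>m q)"
    by (rule eq_matI) auto
  moreover have "1\<^sub>m p \<in> GL p" "1\<^sub>m q \<in> GL q" by (simp_all add: GL_iff)
  ultimately show ?thesis unfolding block_K_def by blast
qed

lemma block_KI:
  assumes k: "k \<in> GL (p + q)"
    and zero: "\<And>r c. r < p + q \<Longrightarrow> c < p + q \<Longrightarrow> (r < p) \<noteq> (c < p) \<Longrightarrow> k $$ (r, c) = 0"
  shows "k \<in> block_K p q"
proof -
  obtain A B C D where s: "split_block k p p = (A, B, C, D)" by (metis prod_cases4)
  have kc: "dim_row k = p + q" "dim_col k = p + q" using GL_carrier[OF k] by auto
  note sb = split_block[OF s kc]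
  have "B = 0\<^sub>m p q"
  proof (rule eq_matI)
    fix i j assume "i < dim_row (0\<^sub>m p q)" "j < dim_col (0\<^sub>m p q)"
    then have ij: "i < p" "j < q" by auto
    have "k $$ (i, p + j) = B $$ (i, j)" using sb(1-4) ij by (subst sb(5)) auto
    then show "B $$ (i, j) = 0\<^sub>m p q $$ (i, j)" using zero[of i "p + j"] ij by simp
  qed (use sb(2) in auto)
  moreover have "C = 0\<^sub>m q p"
  proof (rule eq_matI)
    fix i j assume "i < dim_row (0\<^sub>m q p)" "j < dim_col (0\<^sub>m q p)"
    then have ij: "i < q" "j < p" by auto
    have "k $$ (p + i, j) = C $$ (i, j)" using sb(1-4) ij by (subst sb(5)) auto
    then show "C $$ (i, j) = 0\<^sub>m q p $$ (i, j)" using zero[of "p + i" j] ij by simp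
  qed (use sb(3) in auto)
  ultimately have eq: "k = four_block_mat A (0\<^sub>m p q) (0\<^sub>m q p) D" using sb(5) by simp
  have "det k = det A * det D"
    unfolding eq using sb(1,4) by (intro det_four_block_mat_lower_left_zero) auto
  then have "A \<in> GL p" "D \<in> GL q" using k sb(1,4) by (auto simp: GL_iff)
  with eq show ?thesis unfolding block_K_def by blast
qed

text \<open>The witness is \<open>h\<close> conjugated by the permutation matrix, written entrywise;
  its block condition is then exactly \<open>zero\<close>. Comparing determinants shows that it is
  invertible.\<close>

lemma perm_conj_block_K:
  assumes w: "bij_betw w {..<p + q} {..<p + q}" and h: "h \<in> GL (p + q)"
    and zero: "\<And>r c. r < p + q \<Longrightarrow> c < p + q \<Longrightarrow> (w r < p) \<noteq> (w c < p) \<Longrightarrow> h $$ (r, c) = 0"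
  shows "\<exists>k\<in>block_K p q. k * perm_mat (p + q) w = perm_mat (p + q) w * h"
proof -
  let ?n = "p + q" and ?P = "perm_mat (p + q) w"
  let ?i = "inv_into {..<p + q} w"
  define k where "k = mat ?n ?n (\<lambda>(r, c). h $$ (?i r, ?i c))"
  have kc: "k \<in> carrier_mat ?n ?n" by (simp add: k_def)
  have hc: "h \<in> carrier_mat ?n ?n" using h by (rule GL_carrier)
  have eq: "k * ?P = ?P * h"
  proof (rule eq_matI)
    fix r c assume "r < dim_row (?P * h)" "c < dim_col (?P * h)"
    then have rc: "r < ?n" "c < ?n" using hc by (auto simp: perm_mat_def)
    then show "(k * ?P) $$ (r, c) = (?P * h) $$ (r, c)"
      unfolding mult_perm_mat[OF w kc rc] perm_mat_mult[OF w hc rc]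
      using perm_lt[OF w] w by (auto simp: k_def bij_betw_inv_into_left)
  qed (use hc kc in auto)
  have "det k * det ?P = det ?P * det h"
    using arg_cong[OF eq, of det] kc hc by (simp add: det_mult[of _ ?n])
  then have "k \<in> GL ?n"
    using h kc perm_mat_GL[OF w] by (auto simp: GL_iff)
  then have "k \<in> block_K p q"
  proof (rule block_KI)
    fix r c assume rc: "r < ?n" "c < ?n" "(r < p) \<noteq> (c < p)"
    then have "w (?i r) = r" "w (?i c) = c"
      using bij_betw_inv_into_right[OF w] by simp_all
    then have "h $$ (?i r, ?i c) = 0"
      using rc inv_perm_lt[OF w] zero[of "?i r" "?i c"] by metis
    then show "k $$ (r, c) = 0" using rc by (simp add: k_def)
  qed
  with eq show ?thesis by blast
qed

section \<open>The permutation of a clan\<close>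

text \<open>The rank increases strictly along \<open>A\<close> and stays between 1 and
  \<open>card A\<close>; an injection between finite sets of equal size is onto.\<close>

lemma bij_betw_rank:
  fixes A :: "nat set"
  assumes "finite A"
  shows "bij_betw (\<lambda>i. card {k \<in> A. k \<le> i}) A {1..card A}"
proof -
  have inj: "inj_on (\<lambda>i. card {k \<in> A. k \<le> i}) A"
  proof (rule linorder_inj_onI)
    fix i j assume "i < j" "i \<in> A" "j \<in> A"
    then have "{k \<in> A. k \<le> i} \<subset> {k \<in> A. k \<le> j}" by force
    then have "card {k \<in> A. k \<le> i} < card {k \<in> A. k \<le> j}"
      using assms by (intro psubset_card_mono) auto
    then show "card {k \<in> A. k \<le> i} \<noteq> card {k \<in> A. k \<le> j}" by simp
  qed auto
  have "(\<lambda>i. card {k \<in> A. k \<le> i}) ` A \<subseteq> {1..card A}"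
  proof safe
    fix i assume "i \<in> A"
    then have "{k \<in> A. k \<le> i} \<noteq> {}" "finite {k \<in> A. k \<le> i}" using assms by auto
    then have "card {k \<in> A. k \<le> i} > 0" by (simp add: card_gt_0_iff)
    moreover have "card {k \<in> A. k \<le> i} \<le> card A" using assms by (intro card_mono) auto
    ultimately show "card {k \<in> A. k \<le> i} \<in> {1..card A}" by simp
  qed
  with inj show ?thesis
    by (simp add: bij_betw_def card_image card_subset_eq)
qed

locale clan_setup =
  fixes p q :: nat and \<gamma> :: clan
  assumes clan: "is_clan p q \<gamma>"
begin

abbreviation n :: nat where "n \<equiv> p + q"

lemma arc_bounds: "(i, j) \<in> arcs \<gamma> \<Longrightarrow> 1 \<le> i \<and> i < j \<and> j \<le> n"
  using clan by (auto simp: is_clan_def)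

lemma arc_unique:
  assumes "(i, j) \<in> arcs \<gamma>" "(k, l) \<in> arcs \<gamma>" "i = k \<or> i = l \<or> j = k \<or> j = l"
  shows "i = k \<and> j = l"
  using clan assms unfolding is_clan_def pairwise_def disjnt_def by fastforce

lemma nodes:
  "upper_nodes \<gamma> \<union> lower_nodes \<gamma> = {1..n}" "upper_nodes \<gamma> \<inter> lower_nodes \<gamma> = {}"
proof -
  have *: "plus_nodes \<gamma> \<union> minus_nodes \<gamma> = {1..n} - arc_nodes \<gamma>" "plus_nodes \<gamma> \<inter> minus_nodes \<gamma> = {}"
    using clan by (auto simp: is_clan_def)
  have "arc_nodes \<gamma> \<subseteq> {1..n}" using arc_bounds by (fastforce simp: arc_nodes_def)
  moreover have "upper_nodes \<gamma> \<union> lower_nodes \<gamma> = (plus_nodes \<gamma> \<union> minus_nodes \<gamma>) \<union> arc_nodes \<gamma>"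
    unfolding upper_nodes_def lower_nodes_def arc_nodes_def by (simp only: ac_simps)
  ultimately show "upper_nodes \<gamma> \<union> lower_nodes \<gamma> = {1..n}"
    unfolding *(1) by (simp add: Un_absorb2)
  have "fst ` arcs \<gamma> \<inter> snd ` arcs \<gamma> = {}"
  proof safe
    fix i j k l assume "(i, j) \<in> arcs \<gamma>" "(k, l) \<in> arcs \<gamma>" "fst (i, j) = snd (k, l)"
    then show "fst (i, j) \<in> {}" using arc_unique[of i j k l] arc_bounds[of i j] by simp
  qed
  moreover have "(plus_nodes \<gamma> \<union> minus_nodes \<gamma>) \<inter> arc_nodes \<gamma> = {}"
    unfolding *(1) by (rule Diff_disjoint[THEN trans[OF Int_commute]])
  ultimately show "upper_nodes \<gamma> \<inter> lower_nodes \<gamma> = {}"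
    using *(2) unfolding upper_nodes_def lower_nodes_def arc_nodes_def by blast
qed

text \<open>Left and right ends are equally many, so the difference of the two sizes is
  \<open>p - q\<close> by the sign condition, and their sum is \<open>p + q\<close>.\<close>

lemma card_nodes: "card (upper_nodes \<gamma>) = p" "card (lower_nodes \<gamma>) = q"
proof -
  have fin: "finite (upper_nodes \<gamma>)" "finite (lower_nodes \<gamma>)"
    using nodes(1) by (metis finite_Un finite_atLeastAtMost)+
  have *: "plus_nodes \<gamma> \<union> minus_nodes \<gamma> = {1..n} - arc_nodes \<gamma>"
    using clan by (auto simp: is_clan_def)
  have disj: "(plus_nodes \<gamma> \<union> minus_nodes \<gamma>) \<inter> arc_nodes \<gamma> = {}"
    unfolding * by (rule Diff_disjoint[THEN trans[OF Int_commute]])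
  have "inj_on fst (arcs \<gamma>)" "inj_on snd (arcs \<gamma>)"
    by (rule inj_onI, metis arc_unique prod.collapse)+
  then have "card (fst ` arcs \<gamma>) = card (snd ` arcs \<gamma>)" by (simp add: card_image)
  moreover have "card (upper_nodes \<gamma>) = card (plus_nodes \<gamma>) + card (fst ` arcs \<gamma>)"
    unfolding upper_nodes_def using fin(1) disj
    by (intro card_Un_disjoint) (auto simp: upper_nodes_def arc_nodes_def)
  moreover have "card (lower_nodes \<gamma>) = card (minus_nodes \<gamma>) + card (snd ` arcs \<gamma>)"
    unfolding lower_nodes_def using fin(2) disj
    by (intro card_Un_disjoint) (auto simp: lower_nodes_def arc_nodes_def)
  moreover have "card (upper_nodes \<gamma>) + card (lower_nodes \<gamma>) = p + q"
    using nodes fin card_Un_disjoint[OF fin] by simp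
  moreover have "int (card (plus_nodes \<gamma>)) - int (card (minus_nodes \<gamma>)) = int p - int q"
    using clan by (simp add: is_clan_def)
  ultimately show "card (upper_nodes \<gamma>) = p" "card (lower_nodes \<gamma>) = q" by linarith+
qed

text \<open>Ranks number the upper nodes by the labels up to \<open>p\<close>; shifted by
  \<open>p\<close>, they number the lower nodes by the remaining labels.\<close>

lemma bij_clan_perm: "bij_betw (clan_perm p \<gamma>) {1..n} {1..n}"
  and clan_perm_upper: "i \<in> upper_nodes \<gamma> \<Longrightarrow> clan_perm p \<gamma> i \<in> {1..p}"
  and clan_perm_lower: "i \<in> lower_nodes \<gamma> \<Longrightarrow> clan_perm p \<gamma> i \<in> {p+1..n}"
proof -
  have fin: "finite (upper_nodes \<gamma>)" "finite (lower_nodes \<gamma>)"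
    using nodes(1) by (metis finite_Un finite_atLeastAtMost)+
  have u: "bij_betw (clan_perm p \<gamma>) (upper_nodes \<gamma>) {1..p}"
    using bij_betw_rank[OF fin(1), unfolded card_nodes]
    by (rule bij_betw_cong[THEN iffD1, rotated]) (simp_all add: clan_perm_def card_nodes)
  have "bij_betw ((+) p \<circ> (\<lambda>i. card {k \<in> lower_nodes \<gamma>. k \<le> i})) (lower_nodes \<gamma>) {p+1..n}"
    using bij_betw_rank[OF fin(2), unfolded card_nodes]
    by (rule bij_betw_trans) (auto simp: bij_betw_def)
  then have l: "bij_betw (clan_perm p \<gamma>) (lower_nodes \<gamma>) {p+1..n}"
    by (rule bij_betw_cong[THEN iffD1, rotated]) (use nodes(2) in \<open>auto simp: clan_perm_def\<close>)
  show "bij_betw (clan_perm p \<gamma>) {1..n} {1..n}"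
  proof -
    have "{1..p} \<union> {p+1..n} = {1..n}" by auto
    then show ?thesis using bij_betw_combine[OF u l] nodes(1) by simp
  qed
  show "i \<in> upper_nodes \<gamma> \<Longrightarrow> clan_perm p \<gamma> i \<in> {1..p}"
    using u by (auto simp: bij_betw_def)
  show "i \<in> lower_nodes \<gamma> \<Longrightarrow> clan_perm p \<gamma> i \<in> {p+1..n}"
    using l by (auto simp: bij_betw_def)
qed

text \<open>The permutation with nodes and labels both numbered from 0, to match the matrix indices.\<close>

definition w :: "nat \<Rightarrow> nat" where "w k = clan_perm p \<gamma> (Suc k) - 1"

lemma bij_w: "bij_betw w {..<n} {..<n}"
proof -
  have "bij_betw Suc {..<n} {1..n}" by (auto simp: bij_betw_def image_Suc_lessThan)
  moreover have "bij_betw (\<lambda>k. k - 1) {1..n} {..<n}"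
    by (rule bij_betw_byWitness[of _ Suc]) auto
  ultimately have "bij_betw ((\<lambda>k. k - 1) \<circ> (clan_perm p \<gamma> \<circ> Suc)) {..<n} {..<n}"
    using bij_clan_perm by (blast intro: bij_betw_trans)
  then show ?thesis by (simp add: w_def[abs_def] comp_def)
qed

lemma clan_perm_le_iff: "k < n \<Longrightarrow> clan_perm p \<gamma> (Suc k) \<le> p \<longleftrightarrow> Suc k \<in> upper_nodes \<gamma>"
  and w_less_iff: "k < n \<Longrightarrow> w k < p \<longleftrightarrow> Suc k \<in> upper_nodes \<gamma>"
proof -
  assume "k < n"
  then have k: "Suc k \<in> upper_nodes \<gamma> \<union> lower_nodes \<gamma>" by (simp add: nodes)
  then show "clan_perm p \<gamma> (Suc k) \<le> p \<longleftrightarrow> Suc k \<in> upper_nodes \<gamma>"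
    using clan_perm_upper[of "Suc k"] clan_perm_lower[of "Suc k"] by fastforce
  \<comment> \<open>Labels are at least 1, so the truncated subtraction in \<open>w\<close> loses
    nothing and turns \<open>\<le>\<close> into \<open><\<close>.\<close>
  moreover have "w k < p \<longleftrightarrow> clan_perm p \<gamma> (Suc k) \<le> p"
    using bij_betwE[OF bij_clan_perm, rule_format, of "Suc k"] \<open>k < n\<close> by (simp add: w_def less_eq_Suc_le)
  ultimately show "w k < p \<longleftrightarrow> Suc k \<in> upper_nodes \<gamma>" by simp
qed

end

section \<open>Elementary and diagonal factors that leave a flag unchanged\<close>

lemma upper_triangular_addrow_mat: "k < l \<Longrightarrow> upper_triangular (addrow_mat n a k l)"
  by (rule upper_triangularI) auto

lemma addrow_mat_GL: "k \<noteq> l \<Longrightarrow> addrow_mat n a k l \<in> GL n"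
  by (simp add: GL_iff det_addrow_mat)

text \<open>\<open>addrow_mat n a k l\<close> is the identity with \<open>a\<close> added in row
  \<open>k\<close> and column \<open>l\<close>. For \<open>k < l\<close> it and its inverse, which
  has \<open>- a\<close> instead, are upper triangular.\<close>

lemma flag_of_mult_addrow_mat:
  assumes g: "g \<in> carrier_mat n n" and kl: "k < l" "l < n"
  shows "flag_of n (g * addrow_mat n a k l) = flag_of n g"
  by (rule flag_of_mult_upper_triangular[OF g _ _ _ _ addrow_mat_inv])
    (use kl in \<open>simp_all add: upper_triangular_addrow_mat\<close>)

lemma flag_of_mult_mat_diag:
  assumes g: "g \<in> carrier_mat n n" and f: "\<And>k. f k \<noteq> 0"
  shows "flag_of n (g * mat_diag n f) = flag_of n g"
proof (rule flag_of_mult_upper_triangular[OF g])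
  show "mat_diag n f * mat_diag n (\<lambda>k. inverse (f k)) = 1\<^sub>m n"
    by (rule eq_matI) (simp_all add: mat_diag_mult_left[of _ n n], simp_all add: mat_diag_def f)
qed (auto simp: mat_diag_def intro!: upper_triangularI)

lemma mat_diag_GL:
  assumes "\<And>k. f k \<noteq> 0"
  shows "mat_diag n f \<in> GL n"
proof -
  have "mat_diag n f * mat_diag n (\<lambda>k. inverse (f k)) = 1\<^sub>m n"
    by (rule eq_matI) (simp_all add: mat_diag_mult_left[of _ n n], simp_all add: mat_diag_def assms)
  with det_mult[of "mat_diag n f" n "mat_diag n (\<lambda>k. inverse (f k))"] show ?thesis
    by (auto simp: GL_iff)
qed

section \<open>Degenerations\<close>

context clan_setup
begin

abbreviation P :: "complex mat" where "P \<equiv> perm_mat n w"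

abbreviation Y :: "flag set" where "Y \<equiv> clan_variety p q \<gamma>"

text \<open>An arc has its entry in the row of the right end and the column of the left end. Weights
  1 give the base point of the orbit, weights 0 the identity.\<close>

definition arc_mat :: "(nat \<Rightarrow> complex) \<Rightarrow> complex mat" where
  "arc_mat m = mat n n (\<lambda>(r, c). if r = c then 1 else if (Suc c, Suc r) \<in> arcs \<gamma> then m r else 0)"

lemma arc_mat_carrier [simp]: "arc_mat m \<in> carrier_mat n n"
  by (simp add: arc_mat_def)

lemma arc_mat_GL: "arc_mat m \<in> GL n"
proof -
  have "det (arc_mat m) = prod_list (diag_mat (arc_mat m))"
    using arc_bounds by (intro det_lower_triangular[of n]) (fastforce simp: arc_mat_def)+
  also have "\<dots> = 1"
    unfolding prod_list_diag_prod by (rule prod.neutral) (simp add: arc_mat_def)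
  finally show ?thesis by (simp add: GL_iff)
qed

lemma orbit_subset_Fl: "g \<in> GL n \<Longrightarrow> K_orbit p q (flag_of n g) \<subseteq> Fl n"
  using GL_mult GL_carrier block_K_GL by (auto simp: K_orbit_def Fl_def act_flag_flag_of)

text \<open>Left multiplication by \<open>P\<close> moves the row of a node to the row of its label,
  which turns the columns of the arc matrix into the vectors \<open>clan_vec\<close>.\<close>

lemma clan_flag_eq: "clan_flag p q \<gamma> = flag_of n (P * arc_mat (\<lambda>_. 1))"
proof -
  have "mat_of_cols n (map (clan_vec p q \<gamma>) [1..<n+1]) = P * arc_mat (\<lambda>_. 1)" (is "?M = _")
  proof (rule eq_matI)
    fix r c assume "r < dim_row (P * arc_mat (\<lambda>_. 1))" "c < dim_col (P * arc_mat (\<lambda>_. 1))"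
    then have rc: "r < n" "c < n" by (auto simp: arc_mat_def)
    let ?i = "inv_into {..<n} w r"
    have i: "?i < n" "\<And>k. k < n \<Longrightarrow> r = w k \<longleftrightarrow> ?i = k"
      using inv_perm_lt[OF bij_w rc(1)] perm_eq_iff[OF bij_w rc(1)] by auto
    have "?M $$ (r, c) = clan_vec p q \<gamma> (Suc c) $ r"
      using rc by (simp add: mat_of_cols_index del: upt_Suc)
    also have "\<dots> = arc_mat (\<lambda>_. 1) $$ (?i, c)"
    proof (cases "\<exists>j. (Suc c, j) \<in> arcs \<gamma>")
      case True
      then obtain j where j: "(Suc c, j) \<in> arcs \<gamma>" by blast
      have "(THE j. (Suc c, j) \<in> arcs \<gamma>) = j"
        using j arc_unique by (intro the_equality) blast+
      moreover have jb: "1 \<le> j" "j \<le> n" "Suc c < j" using arc_bounds[OF j] by auto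
      moreover have "(Suc c, Suc ?i) \<in> arcs \<gamma> \<longleftrightarrow> Suc ?i = j"
        using j arc_unique[OF j, of "Suc c" "Suc ?i"] by blast
      moreover have "clan_perm p \<gamma> j - Suc 0 = w (j - 1)" using jb by (simp add: w_def)
      ultimately show ?thesis
        using True rc i(1) i(2)[of c] i(2)[of "j - 1"]
        by (auto simp: clan_vec_def basis_vec_def arc_mat_def unit_vec_def w_def)
    next
      case False
      then show ?thesis
        using rc i(1) i(2)[of c]
        by (auto simp: clan_vec_def basis_vec_def arc_mat_def unit_vec_def w_def)
    qed
    also have "\<dots> = (P * arc_mat (\<lambda>_. 1)) $$ (r, c)"
      using perm_mat_mult[OF bij_w arc_mat_carrier rc] by simp
    finally show "?M $$ (r, c) = (P * arc_mat (\<lambda>_. 1)) $$ (r, c)" .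
  qed (auto simp: arc_mat_def simp del: upt_Suc)
  then show ?thesis by (simp add: clan_flag_def)
qed

lemma curve_mat_eq:
  assumes "1 \<le> a" "a < b" "b \<le> n"
  shows "curve_mat n (clan_perm p \<gamma>) a b z = P * addrow_mat n z (b - 1) (a - 1)"
proof (rule eq_matI)
  fix r c assume "r < dim_row (P * addrow_mat n z (b - 1) (a - 1))" "c < dim_col (P * addrow_mat n z (b - 1) (a - 1))"
  then have rc: "r < n" "c < n" by auto
  let ?i = "inv_into {..<n} w r"
  have i: "?i < n" "\<And>k. k < n \<Longrightarrow> r = w k \<longleftrightarrow> ?i = k"
    using inv_perm_lt[OF bij_w rc(1)] perm_eq_iff[OF bij_w rc(1)] by auto
  have "clan_perm p \<gamma> b - Suc 0 = w (b - 1)" using assms by (simp add: w_def)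
  then have "curve_mat n (clan_perm p \<gamma>) a b z $$ (r, c) = addrow_mat n z (b - 1) (a - 1) $$ (?i, c)"
    using rc assms i(1) i(2)[of c] i(2)[of "b - 1"]
    by (auto simp: curve_mat_def mat_of_cols_index basis_vec_def unit_vec_def w_def simp del: upt_Suc)
  then show "curve_mat n (clan_perm p \<gamma>) a b z $$ (r, c) = (P * addrow_mat n z (b - 1) (a - 1)) $$ (r, c)"
    using perm_mat_mult[OF bij_w addrow_mat_carrier rc] by simp
qed (auto simp: curve_mat_def simp del: upt_Suc)

lemma P_mult_GL: "X \<in> GL n \<Longrightarrow> P * X \<in> GL n"
  using perm_mat_GL[OF bij_w] by (rule GL_mult)

section \<open>The K-orbit and moves that preserve membership in its closure\<close>

lemma orbit_flag_iff:
  "V \<in> K_orbit p q (clan_flag p q \<gamma>) \<longleftrightarrow> (\<exists>k\<in>block_K p q. V = flag_of n (k * (P * arc_mat (\<lambda>_. 1))))"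
proof -
  have "act_flag k (clan_flag p q \<gamma>) = flag_of n (k * (P * arc_mat (\<lambda>_. 1)))" if "k \<in> block_K p q" for k
    unfolding clan_flag_eq
    by (rule act_flag_flag_of[OF GL_carrier[OF block_K_GL[OF that]] GL_carrier[OF P_mult_GL[OF arc_mat_GL]]])
  then have "(\<lambda>k. act_flag k (clan_flag p q \<gamma>)) ` block_K p q
      = (\<lambda>k. flag_of n (k * (P * arc_mat (\<lambda>_. 1)))) ` block_K p q"
    by (rule image_cong[OF refl])
  moreover have "K_orbit p q (clan_flag p q \<gamma>) = (\<lambda>k. act_flag k (clan_flag p q \<gamma>)) ` block_K p q"
    unfolding K_orbit_def by blast
  ultimately show ?thesis by (simp add: image_iff)
qed

lemma orbit_stable:
  assumes k: "k \<in> block_K p q" and V: "V \<in> K_orbit p q (clan_flag p q \<gamma>)"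
  shows "act_flag k V \<in> K_orbit p q (clan_flag p q \<gamma>)"
proof -
  let ?X = "P * arc_mat (\<lambda>_. 1)"
  obtain l where l: "l \<in> block_K p q" "V = flag_of n (l * ?X)"
    using V unfolding orbit_flag_iff by blast
  note c = GL_carrier[OF block_K_GL[OF k]] GL_carrier[OF block_K_GL[OF l(1)]]
    GL_carrier[OF P_mult_GL[OF arc_mat_GL]]
  have "act_flag k V = flag_of n (k * (l * ?X))"
    unfolding l(2) by (rule act_flag_flag_of[OF c(1) mult_carrier_mat[OF c(2,3)]])
  also have "k * (l * ?X) = (k * l) * ?X"
    by (rule assoc_mult_mat[OF c(1,2,3), symmetric])
  finally show ?thesis
    unfolding orbit_flag_iff using block_K_mult[OF k l(1)] by blast
qed

lemma closedin_Y: "closedin (Fl_zariski n) Y"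
  by (simp add: clan_variety_def)

lemma orbit_subset_Y: "K_orbit p q (clan_flag p q \<gamma>) \<subseteq> Y"
  unfolding clan_variety_def clan_flag_eq
  by (intro closure_of_subset) (simp add: topspace_Fl_zariski orbit_subset_Fl P_mult_GL arc_mat_GL)

definition in_Y :: "complex mat \<Rightarrow> bool" where
  "in_Y X \<longleftrightarrow> flag_of n (P * X) \<in> Y"

text \<open>By \<open>zero\<close>, \<open>h\<close> lies in the conjugate of K by \<open>P\<close>,
  so multiplying by \<open>h\<close> acts on the flag of \<open>P * X\<close> as an element of K,
  and the orbit closure is K-stable.\<close>

lemma in_Y_left:
  assumes X: "X \<in> GL n" "in_Y X" and h: "h \<in> GL n"
    and zero: "\<And>r c. r < n \<Longrightarrow> c < n \<Longrightarrow> (w r < p) \<noteq> (w c < p) \<Longrightarrow> h $$ (r, c) = 0"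
  shows "in_Y (h * X)"
proof -
  obtain k where k: "k \<in> block_K p q" "k * P = P * h"
    using perm_conj_block_K[OF bij_w h zero] by blast
  note c = GL_carrier[OF block_K_GL[OF k(1)]] GL_carrier[OF X(1)] GL_carrier[OF h]
  have "act_flag k (flag_of n (P * X)) \<in> Y"
    using act_flag_closure_of[OF block_K_GL[OF k(1)] orbit_stable[OF k(1)]] X(2)
    unfolding in_Y_def clan_variety_def by blast
  also have "act_flag k (flag_of n (P * X)) = flag_of n (k * (P * X))"
    using c by (intro act_flag_flag_of) auto
  also have "k * (P * X) = (k * P) * X"
    using c by (intro assoc_mult_mat[symmetric]) auto
  also have "\<dots> = P * (h * X)"
    unfolding k(2) using c by (intro assoc_mult_mat) auto
  finally show ?thesis unfolding in_Y_def .
qed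

lemma in_Y_left_addrow:
  assumes "X \<in> GL n" "in_Y X" "k \<noteq> l" "k < n" "l < n" "w k < p \<longleftrightarrow> w l < p"
  shows "in_Y (addrow_mat n s k l * X)"
  using assms by (intro in_Y_left addrow_mat_GL) (auto split: if_splits)

lemma in_Y_right_addrow:
  assumes "X \<in> GL n" "in_Y X" "k < l" "l < n"
  shows "in_Y (X * addrow_mat n s k l)"
proof -
  have c: "X \<in> carrier_mat n n" using assms(1) by (rule GL_carrier)
  have "P * (X * addrow_mat n s k l) = (P * X) * addrow_mat n s k l"
    using c by (intro assoc_mult_mat[symmetric]) auto
  then show ?thesis
    using assms flag_of_mult_addrow_mat[OF mult_carrier_mat[OF perm_mat_carrier c], where k = k and l = l] by (simp add: in_Y_def)
qed

lemma in_Y_limit: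
  fixes G :: "complex \<Rightarrow> complex mat"
  assumes "\<And>t. G t \<in> GL n" "\<And>i j. i < n \<Longrightarrow> j < n \<Longrightarrow> isCont (\<lambda>t. G t $$ (i, j)) 0"
    and "\<And>t. t \<noteq> 0 \<Longrightarrow> in_Y (G t)"
  shows "in_Y (G 0)"
  unfolding in_Y_def
proof (rule closedin_Fl_zariski_limit[OF closedin_Y, where G = "\<lambda>t. P * G t"])
  show "P * G t \<in> GL n" for t using assms(1) by (rule P_mult_GL)
  fix i j assume ij: "i < n" "j < n"
  have "(\<lambda>t. (P * G t) $$ (i, j)) = (\<lambda>t. G t $$ (inv_into {..<n} w i, j))"
    using perm_mat_mult[OF bij_w GL_carrier[OF assms(1)] ij] by auto
  then show "isCont (\<lambda>t. (P * G t) $$ (i, j)) 0"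
    using assms(2) inv_perm_lt[OF bij_w] ij by simp
qed (use assms(3) in_Y_def in auto)

text \<open>Conjugation by a torus of K rescales the arcs independently of each other.\<close>

lemma in_Y_arc_mat_nonzero:
  assumes m: "\<And>r. m r \<noteq> 0"
  shows "in_Y (arc_mat m)"
proof -
  \<comment> \<open>Scaling rows by \<open>d\<close> and columns by its inverse multiplies the entry
    of an arc in row \<open>r\<close> and column \<open>c\<close> by \<open>d r / d c\<close>, which
    is to be \<open>m r\<close>.\<close>
  define d where "d r = (if \<exists>i. (i, Suc r) \<in> arcs \<gamma> then m r else 1)" for r
  have d: "d r \<noteq> 0" for r using m by (simp add: d_def)
  let ?X = "arc_mat (\<lambda>_. 1)"
  have "in_Y ?X"
    unfolding in_Y_def clan_flag_eq[symmetric] using orbit_subset_Y orbit_flag_iff[of "clan_flag p q \<gamma>"]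
      one_block_K[of p q] left_mult_one_mat[OF GL_carrier[OF P_mult_GL[OF arc_mat_GL]]]
    by (metis clan_flag_eq subsetD)
  then have "in_Y (mat_diag n d * ?X)"
    by (intro in_Y_left arc_mat_GL mat_diag_GL d) (auto simp: mat_diag_def)
  then have "flag_of n ((P * (mat_diag n d * ?X)) * mat_diag n (\<lambda>k. inverse (d k))) \<in> Y"
    unfolding in_Y_def
    by (subst flag_of_mult_mat_diag[OF mult_carrier_mat[OF perm_mat_carrier mult_carrier_mat[OF mat_diag_dim]]])
      (auto simp: d)
  also have "(P * (mat_diag n d * ?X)) * mat_diag n (\<lambda>k. inverse (d k))
      = P * ((mat_diag n d * ?X) * mat_diag n (\<lambda>k. inverse (d k)))"
    by (intro assoc_mult_mat[of _ n n _ n _ n] perm_mat_carrier mat_diag_dim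
        mult_carrier_mat[OF mat_diag_dim arc_mat_carrier])
  also have "(mat_diag n d * ?X) * mat_diag n (\<lambda>k. inverse (d k)) = arc_mat m"
  proof (rule eq_matI)
    fix r c assume "r < dim_row (arc_mat m)" "c < dim_col (arc_mat m)"
    then have rc: "r < n" "c < n" by (auto simp: arc_mat_def)
    have "((mat_diag n d * ?X) * mat_diag n (\<lambda>k. inverse (d k))) $$ (r, c)
        = d r * ?X $$ (r, c) * inverse (d c)"
      using rc by (simp add: mat_diag_mult_left[of _ n n] mat_diag_mult_right[of _ n n])
    also have "\<dots> = arc_mat m $$ (r, c)"
    proof (cases "r \<noteq> c \<and> (Suc c, Suc r) \<in> arcs \<gamma>")
      case True
      \<comment> \<open>A left end is never a right end, hence \<open>d c = 1\<close>.\<close>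
      then have "\<not> (\<exists>i. (i, Suc c) \<in> arcs \<gamma>)"
        using arc_unique[of "Suc c" "Suc r" _ "Suc c"] by fastforce
      then show ?thesis using True rc by (auto simp: arc_mat_def d_def)
    next
      case False
      then show ?thesis using rc d by (auto simp: arc_mat_def)
    qed
    finally show "((mat_diag n d * ?X) * mat_diag n (\<lambda>k. inverse (d k))) $$ (r, c) = arc_mat m $$ (r, c)" .
  qed (auto simp: arc_mat_def mat_diag_def)
  finally show ?thesis unfolding in_Y_def .
qed

text \<open>Zero weights are replaced by \<open>t\<close> and recovered in the limit, so any set of
  arcs can be switched off.\<close>

lemma in_Y_arc_mat: "in_Y (arc_mat m)"
proof -
  define G where "G t = arc_mat (\<lambda>r. if m r = 0 then t else m r)" for t
  have "isCont (\<lambda>t. G t $$ (i, j)) 0" if "i < n" "j < n" for i j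
    using that by (cases "i = j"; cases "(Suc j, Suc i) \<in> arcs \<gamma>"; cases "m i = 0") (simp_all add: G_def arc_mat_def)
  then have "in_Y (G 0)"
    by (intro in_Y_limit[of G]) (simp_all add: G_def arc_mat_GL in_Y_arc_mat_nonzero)
  also have "(\<lambda>r. if m r = 0 then 0 else m r) = m" by auto
  then have "G 0 = arc_mat m" by (simp add: G_def)
  finally show ?thesis .
qed

lemma in_Y_one: "in_Y (1\<^sub>m n)"
proof -
  have "arc_mat (\<lambda>_. 0) = 1\<^sub>m n" by (rule eq_matI) (auto simp: arc_mat_def)
  then show ?thesis using in_Y_arc_mat[of "\<lambda>_. 0"] by simp
qed

lemma in_Y_single_arc:
  assumes "(Suc i, Suc j) \<in> arcs \<gamma>"
  shows "in_Y (addrow_mat n c j i)"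
proof -
  have "arc_mat (\<lambda>r. if r = j then c else 0) = addrow_mat n c j i"
  proof (rule eq_matI)
    fix r s assume "r < dim_row (addrow_mat n c j i)" "s < dim_col (addrow_mat n c j i)"
    then show "arc_mat (\<lambda>r. if r = j then c else 0) $$ (r, s) = addrow_mat n c j i $$ (r, s)"
      using assms arc_unique[OF assms, of "Suc s" "Suc j"] arc_bounds[OF assms]
      by (auto simp: arc_mat_def)
  qed (auto simp: arc_mat_def)
  then show ?thesis using in_Y_arc_mat by metis
qed

text \<open>The arc \<open>(i, j)\<close> is slid to \<open>(a, j)\<close>: the one-parameter family
  \<open>(1 + s E\<^sub>i\<^sub>a) (1 + t E\<^sub>j\<^sub>i) (1 - s E\<^sub>i\<^sub>a) = 1 + t E\<^sub>j\<^sub>i - s t E\<^sub>j\<^sub>a\<close> with \<open>s t = - z\<close> fixed converges to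
  \<open>1 + z E\<^sub>j\<^sub>a\<close>. The right end is moved in the same way.\<close>

lemma in_Y_slide_left:
  assumes Y: "\<And>t. in_Y (addrow_mat n t j i)" and "i < a" "a < j" "j < n" "w i < p" "w a < p"
  shows "in_Y (addrow_mat n z j a)"
proof -
  define G where "G t = mat n n (\<lambda>(r, c). if r = c then 1 else if r = j \<and> c = i then t
      else if r = j \<and> c = a then z else 0)" for t :: complex
  \<comment> \<open>The new entry depends only on \<open>s * t\<close>, so it stays at
    \<open>z\<close> while \<open>t\<close> tends to 0 and \<open>s\<close> grows.\<close>
  have eq: "addrow_mat n s i a * addrow_mat n t j i * addrow_mat n (- s) i a = G t"
    if "s * t = - z" for s t
  proof -
    have "addrow_mat n s i a * addrow_mat n t j i = addrow s i a (addrow_mat n t j i)"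
      using assms by (intro addrow_mat[symmetric]) auto
    then have "addrow_mat n s i a * addrow_mat n t j i * addrow_mat n (- s) i a
        = addcol (- s) a i (addrow s i a (addrow_mat n t j i))"
      using assms by (simp add: addcol_mat[of _ n n])
    also have "\<dots> = G t"
      by (rule eq_matI) (use assms that in \<open>auto simp: G_def\<close>)
    finally show ?thesis .
  qed
  have GL: "G t \<in> GL n" for t
  proof -
    have "det (G t) = prod_list (diag_mat (G t))"
      by (rule det_lower_triangular[of n]) (use assms in \<open>auto simp: G_def\<close>)
    also have "\<dots> = 1"
      unfolding prod_list_diag_prod by (rule prod.neutral) (simp add: G_def)
    finally show ?thesis by (simp add: GL_iff G_def)
  qed
  have "in_Y (G 0)"
  proof (rule in_Y_limit[OF GL])
    show "isCont (\<lambda>t. G t $$ (r, c)) 0" if "r < n" "c < n" for r c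
      using that by (cases "r = c"; cases "r = j \<and> c = i") (auto simp: G_def)
    fix t :: complex assume "t \<noteq> 0"
    then have st: "(- z / t) * t = - z" by simp
    \<comment> \<open>The left factor is allowed because \<open>i\<close> and \<open>a\<close> are
      both upper nodes, the right factor added next because \<open>i < a\<close> makes it
      triangular.\<close>
    have "in_Y (addrow_mat n (- z / t) i a * addrow_mat n t j i)"
      by (rule in_Y_left_addrow[OF addrow_mat_GL Y]) (use assms in auto)
    then have "in_Y (addrow_mat n (- z / t) i a * addrow_mat n t j i * addrow_mat n (- (- z / t)) i a)"
      by (rule in_Y_right_addrow[rotated]) (use assms in \<open>auto intro!: GL_mult addrow_mat_GL\<close>)
    then show "in_Y (G t)"
      unfolding eq[OF st] .
  qed
  also have "G 0 = addrow_mat n z j a"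
    by (rule eq_matI) (use assms in \<open>auto simp: G_def\<close>)
  finally show ?thesis .
qed

text \<open>Here \<open>(1 + s E_bj) (1 + t E_ja) (1 - s E_bj) = 1 + t E_ja + s t E_ba\<close>, with
  \<open>s t = z\<close> fixed. Both \<open>b\<close> and \<open>j\<close> are lower nodes, and
  \<open>b < j\<close> makes the last factor triangular.\<close>

lemma in_Y_slide_right:
  assumes Y: "\<And>t. in_Y (addrow_mat n t j a)" and "a < b" "b < j" "j < n" "p \<le> w j" "p \<le> w b"
  shows "in_Y (addrow_mat n z b a)"
proof -
  define G where "G t = mat n n (\<lambda>(r, c). if r = c then 1 else if r = j \<and> c = a then t
      else if r = b \<and> c = a then z else 0)" for t :: complex
  have eq: "addrow_mat n s b j * addrow_mat n t j a * addrow_mat n (- s) b j = G t"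
    if "s * t = z" for s t
  proof -
    have "addrow_mat n s b j * addrow_mat n t j a = addrow s b j (addrow_mat n t j a)"
      using assms by (intro addrow_mat[symmetric]) auto
    then have "addrow_mat n s b j * addrow_mat n t j a * addrow_mat n (- s) b j
        = addcol (- s) j b (addrow s b j (addrow_mat n t j a))"
      using assms by (simp add: addcol_mat[of _ n n])
    also have "\<dots> = G t"
      by (rule eq_matI) (use assms that in \<open>auto simp: G_def\<close>)
    finally show ?thesis .
  qed
  have GL: "G t \<in> GL n" for t
  proof -
    have "det (G t) = prod_list (diag_mat (G t))"
      by (rule det_lower_triangular[of n]) (use assms in \<open>auto simp: G_def\<close>)
    also have "\<dots> = 1"
      unfolding prod_list_diag_prod by (rule prod.neutral) (simp add: G_def)
    finally show ?thesis by (simp add: GL_iff G_def)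
  qed
  have "in_Y (G 0)"
  proof (rule in_Y_limit[OF GL])
    show "isCont (\<lambda>t. G t $$ (r, c)) 0" if "r < n" "c < n" for r c
      using that by (cases "r = c"; cases "r = j \<and> c = a") (auto simp: G_def)
    fix t :: complex assume "t \<noteq> 0"
    then have st: "(z / t) * t = z" by simp
    have "in_Y (addrow_mat n (z / t) b j * addrow_mat n t j a)"
      by (rule in_Y_left_addrow[OF addrow_mat_GL Y]) (use assms in auto)
    then have "in_Y (addrow_mat n (z / t) b j * addrow_mat n t j a * addrow_mat n (- (z / t)) b j)"
      by (rule in_Y_right_addrow[rotated]) (use assms in \<open>auto intro!: GL_mult addrow_mat_GL\<close>)
    then show "in_Y (G t)"
      unfolding eq[OF st] .
  qed
  also have "G 0 = addrow_mat n z b a"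
    by (rule eq_matI) (use assms in \<open>auto simp: G_def\<close>)
  finally show ?thesis .
qed

lemma in_Y_same_side:
  assumes "a < b" "b < n" "w a < p \<longleftrightarrow> w b < p"
  shows "in_Y (addrow_mat n z b a)"
proof -
  have "in_Y (addrow_mat n z b a * 1\<^sub>m n)"
    using assms by (intro in_Y_left_addrow in_Y_one) (auto simp: GL_iff)
  then show ?thesis by simp
qed

text \<open>The left end slides from \<open>i\<close> to \<open>a\<close> first, for every weight
  \<open>t\<close>, because sliding the right end from \<open>j\<close> to \<open>b\<close> starts
  from the whole family.\<close>

lemma in_Y_under_arc:
  assumes ij: "(Suc i, Suc j) \<in> arcs \<gamma>" and "i \<le> a" "a < b" "b \<le> j" "w a < p" "p \<le> w b"
  shows "in_Y (addrow_mat n z b a)"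
proof -
  have bounds: "i < j" "j < n" using arc_bounds[OF ij] by auto
  have "Suc i \<in> upper_nodes \<gamma>" using ij by (force simp: upper_nodes_def)
  then have wi: "w i < p" using w_less_iff[of i] bounds by simp
  have "Suc j \<in> lower_nodes \<gamma>" using ij by (force simp: lower_nodes_def)
  then have wj: "p \<le> w j" using w_less_iff[of j] bounds nodes(2) by (auto simp: not_less[symmetric])
  have "in_Y (addrow_mat n t j a)" for t
    using in_Y_single_arc[OF ij] in_Y_slide_left[of j i a t] assms bounds wi
    by (cases "i = a") auto
  then show ?thesis
    using in_Y_slide_right[of j a b z] assms bounds wj by (cases "b = j") auto
qed

text \<open>\<open>Y\<close> is closed, so it contains the closure as soon as it contains the affine
  points; the point at infinity is automatic.\<close>

lemma T_curve_subset_iff: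
  assumes "1 \<le> a" "a < b" "b \<le> n"
  shows "T_curve n (clan_perm p \<gamma>) a b \<subseteq> Y \<longleftrightarrow> (\<forall>z. in_Y (addrow_mat n z (b - 1) (a - 1)))"
proof -
  let ?C = "range (\<lambda>z. flag_of n (curve_mat n (clan_perm p \<gamma>) a b z))"
  have eq: "?C = range (\<lambda>z. flag_of n (P * addrow_mat n z (b - 1) (a - 1)))"
    by (simp only: curve_mat_eq[OF assms])
  have "?C \<subseteq> Fl n"
    unfolding eq Fl_def using assms by (auto intro!: P_mult_GL addrow_mat_GL)
  then have "?C \<subseteq> T_curve n (clan_perm p \<gamma>) a b"
    unfolding T_curve_def by (intro closure_of_subset) (simp add: topspace_Fl_zariski)
  moreover have "T_curve n (clan_perm p \<gamma>) a b \<subseteq> Y" if "?C \<subseteq> Y"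
    unfolding T_curve_def using that closedin_Y by (rule closure_of_minimal)
  ultimately have "T_curve n (clan_perm p \<gamma>) a b \<subseteq> Y \<longleftrightarrow> ?C \<subseteq> Y" by blast
  then show ?thesis unfolding eq in_Y_def by (simp add: image_subset_iff)
qed

end

section \<open>Rank conditions\<close>

lemma block_K_zero:
  assumes "k \<in> block_K p q" "r < p + q" "c < p + q" "(r < p) \<noteq> (c < p)"
  shows "k $$ (r, c) = 0"
proof -
  obtain g h where gh: "g \<in> GL p" "h \<in> GL q" and k: "k = four_block_mat g (0\<^sub>m p q) (0\<^sub>m q p) h"
    using assms(1) by (auto simp: block_K_def)
  have c: "dim_row g = p" "dim_col g = p" "dim_row h = q" "dim_col h = q"
    using gh[THEN GL_carrier] by auto
  show ?thesis
    unfolding k using c assms(2-4) by (subst index_mat_four_block) auto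
qed

lemma mult_mat_vec_index:
  assumes "A \<in> carrier_mat n n" "x \<in> carrier_vec n" "r < n"
  shows "(A *\<^sub>v x) $ r = (\<Sum>k = 0..<n. A $$ (r, k) * x $ k)"
  using assms by (auto simp: scalar_prod_def)

lemma mult_unit_vec_index:
  fixes A :: "complex mat"
  assumes "A \<in> carrier_mat n n" "r < n" "c < n"
  shows "(A *\<^sub>v unit_vec n c) $ r = A $$ (r, c)"
  using assms by (subst index_mult_mat_vec) auto

lemma unit_vec_coord_space: "c < n \<Longrightarrow> unit_vec n c \<in> coord_space n (Suc c)"
  by (auto simp: coord_space_def)

context clan_setup
begin

abbreviation X :: "complex mat" where "X \<equiv> P * arc_mat (\<lambda>_. 1)"

lemma arc_mat_mult_vec_no_arc:
  assumes x: "x \<in> carrier_vec n" and r: "r < n" and no: "\<And>c. (Suc c, Suc r) \<notin> arcs \<gamma>"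
  shows "(arc_mat m *\<^sub>v x) $ r = x $ r"
proof -
  have "(arc_mat m *\<^sub>v x) $ r = (\<Sum>k = 0..<n. if r = k then x $ k else 0)"
    unfolding mult_mat_vec_index[OF arc_mat_carrier x r]
    using r no by (intro sum.cong) (auto simp: arc_mat_def)
  then show ?thesis using r by simp
qed

lemma arc_mat_mult_vec_arc:
  assumes x: "x \<in> carrier_vec n" and cr: "(Suc c, Suc r) \<in> arcs \<gamma>"
  shows "(arc_mat m *\<^sub>v x) $ r = x $ r + m r * x $ c"
proof -
  have b: "c < r" "r < n" using arc_bounds[OF cr] by auto
  have "(arc_mat m *\<^sub>v x) $ r = (\<Sum>k = 0..<n. (if r = k then x $ k else 0) + (if c = k then m r * x $ k else 0))"
    unfolding mult_mat_vec_index[OF arc_mat_carrier x b(2)]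
  proof (rule sum.cong)
    fix k assume k: "k \<in> {0..<n}"
    have "(Suc k, Suc r) \<in> arcs \<gamma> \<longleftrightarrow> k = c" using cr arc_unique[OF cr, of "Suc k" "Suc r"] by auto
    then show "arc_mat m $$ (r, k) * x $ k = (if r = k then x $ k else 0) + (if c = k then m r * x $ k else 0)"
      using k b by (simp add: arc_mat_def)
  qed simp
  also have "\<dots> = x $ r + m r * x $ c"
    unfolding sum.distrib using b by simp
  finally show ?thesis .
qed

lemma right_end_lower: "(Suc c, Suc r) \<in> arcs \<gamma> \<Longrightarrow> p \<le> w r"
proof -
  assume cr: "(Suc c, Suc r) \<in> arcs \<gamma>"
  then have "Suc r \<in> lower_nodes \<gamma>" by (force simp: lower_nodes_def)
  then have "Suc r \<notin> upper_nodes \<gamma>" using nodes(2) by blast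
  then show ?thesis using w_less_iff[of r] arc_bounds[OF cr] by auto
qed

lemma left_end_upper: "(Suc c, Suc r) \<in> arcs \<gamma> \<Longrightarrow> w c < p"
proof -
  assume cr: "(Suc c, Suc r) \<in> arcs \<gamma>"
  then have "Suc c \<in> upper_nodes \<gamma>" by (force simp: upper_nodes_def)
  then show ?thesis using w_less_iff[of c] arc_bounds[OF cr] by auto
qed

text \<open>K preserves the splitting into the first \<open>p\<close> and the last \<open>q\<close>
  coordinates, and arcs alter only the rows of right ends, which are lower. So projecting the image
  amounts to truncating \<open>d\<close> to upper nodes and dropping the arcs.\<close>

lemma project_orbit:
  assumes k: "k \<in> block_K p q" and d: "d \<in> carrier_vec n" and r: "r < n"
  shows "(if r < p then ((k * X) *\<^sub>v d) $ r else 0)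
    = ((k * P) *\<^sub>v vec n (\<lambda>s. if w s < p then d $ s else 0)) $ r"
proof -
  let ?A = "arc_mat (\<lambda>_. 1)"
  have kc: "k \<in> carrier_mat n n" using GL_carrier[OF block_K_GL[OF k]] .
  have kP: "k * P \<in> carrier_mat n n" using kc by simp
  have Ad: "?A *\<^sub>v d \<in> carrier_vec n" by (rule mult_mat_vec_carrier[OF arc_mat_carrier d])
  have "(k * X) *\<^sub>v d = (k * P) *\<^sub>v (?A *\<^sub>v d)"
    unfolding assoc_mult_mat[OF kc perm_mat_carrier arc_mat_carrier, symmetric]
    by (rule assoc_mult_mat_vec[OF kP arc_mat_carrier d])
  then have "((k * X) *\<^sub>v d) $ r = (\<Sum>s = 0..<n. (k * P) $$ (r, s) * (?A *\<^sub>v d) $ s)"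
    by (simp only: mult_mat_vec_index[OF kP Ad r])
  then have "(if r < p then ((k * X) *\<^sub>v d) $ r else 0)
      = (\<Sum>s = 0..<n. (if r < p then (k * P) $$ (r, s) * (?A *\<^sub>v d) $ s else 0))"
    by simp
  also have "\<dots> = (\<Sum>s = 0..<n. (k * P) $$ (r, s) * vec n (\<lambda>s. if w s < p then d $ s else 0) $ s)"
  proof (rule sum.cong)
    fix s assume "s \<in> {0..<n}"
    then have s: "s < n" by simp
    have "(k * P) $$ (r, s) = 0" if "(r < p) \<noteq> (w s < p)"
      using mult_perm_mat[OF bij_w kc r s] block_K_zero[OF k r perm_lt[OF bij_w s] that] by simp
    moreover have "(?A *\<^sub>v d) $ s = d $ s" if "w s < p"
      using right_end_lower[of _ s] that by (intro arc_mat_mult_vec_no_arc d s) (metis not_le)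
    ultimately show "(if r < p then (k * P) $$ (r, s) * (?A *\<^sub>v d) $ s else 0)
        = (k * P) $$ (r, s) * vec n (\<lambda>s. if w s < p then d $ s else 0) $ s"
      using s by (cases "r < p"; cases "w s < p") simp_all
  qed simp
  also have "\<dots> = ((k * P) *\<^sub>v vec n (\<lambda>s. if w s < p then d $ s else 0)) $ r"
    by (rule mult_mat_vec_index[OF kP _ r, symmetric]) simp
  finally show ?thesis .
qed

text \<open>Column \<open>c\<close> of \<open>g\<close> lies in space \<open>Suc c\<close> of the
  flag of \<open>k * X\<close>; its projection is then a combination of the columns of
  \<open>k * P\<close> at upper nodes up to \<open>c\<close>.\<close>

lemma orbit_column:
  assumes g: "g \<in> carrier_mat n n" "flag_of n g = flag_of n (k * X)" and k: "k \<in> block_K p q" and c: "c < n"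
  shows "\<exists>d\<in>coord_space n (Suc c). \<forall>r<n. (if r < p then g $$ (r, c) else 0)
    = ((k * P) *\<^sub>v vec n (\<lambda>s. if w s < p then d $ s else 0)) $ r"
proof -
  have kX: "k * X \<in> carrier_mat n n"
    using GL_carrier[OF GL_mult[OF block_K_GL[OF k] P_mult_GL[OF arc_mat_GL]]] .
  have "g *\<^sub>v unit_vec n c \<in> flag_of n (k * X) (Suc c)"
    unfolding g(2)[symmetric] flag_of_eq[OF g(1)] using unit_vec_coord_space[OF c] by blast
  then obtain d where d: "d \<in> coord_space n (Suc c)" "g *\<^sub>v unit_vec n c = (k * X) *\<^sub>v d"
    unfolding flag_of_eq[OF kX] by blast
  then have dc: "d \<in> carrier_vec n" by (simp add: coord_space_def)
  have "g $$ (r, c) = ((k * X) *\<^sub>v d) $ r" if "r < n" for r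
    using mult_unit_vec_index[OF g(1) that c] d(2) by simp
  then have "(if r < p then g $$ (r, c) else 0)
      = ((k * P) *\<^sub>v vec n (\<lambda>s. if w s < p then d $ s else 0)) $ r" if "r < n" for r
    using project_orbit[OF k dc that] that by (simp only:)
  with d(1) show ?thesis by blast
qed

section \<open>Determinants that obstruct the two excluded cases\<close>

lemma P_mult_addrow_index:
  assumes "a < b" "b < n" "r < n" "c < n"
  shows "(P * addrow_mat n 1 b a) $$ (r, c) = (if r = w c \<or> (r = w b \<and> c = a) then 1 else 0)"
  using assms perm_mat_mult[OF bij_w addrow_mat_carrier assms(3,4), of 1 b a] inv_perm_lt[OF bij_w assms(3)]
    perm_eq_iff[OF bij_w assms(3), of b] perm_eq_iff[OF bij_w assms(3), of c]
  by auto

lemma perm_mat_transpose_GL: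
  assumes "a < n" "b < n"
  shows "perm_mat n (w \<circ> Transposition.transpose a b) \<in> GL n"
proof (rule perm_mat_GL, rule bij_betw_trans[OF _ bij_w])
  show "bij_betw (Transposition.transpose a b) {..<n} {..<n}"
    using assms by (intro permutes_imp_bij permutes_swap_id) auto
qed

text \<open>A rank condition is encoded by a matrix \<open>N g\<close> depending polynomially on
  \<open>g\<close>. If it is singular on the orbit, it stays singular on the closure.\<close>

lemma det_vanishes_in_Y:
  assumes N: "\<And>g. g \<in> carrier_mat n n \<Longrightarrow> N g \<in> carrier_mat n n"
    and entries: "\<And>i j. i < n \<Longrightarrow> j < n \<Longrightarrow> polyfun_on n (\<lambda>g. N g $$ (i, j))"
    and vanish: "\<And>g k. g \<in> GL n \<Longrightarrow> k \<in> block_K p q \<Longrightarrow> flag_of n g = flag_of n (k * X) \<Longrightarrow> det (N g) = 0"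
    and Z: "Z \<in> GL n" "in_Y Z"
  shows "det (N (P * Z)) = 0"
proof (rule polyfun_vanishes_on_closure[OF polyfun_on_compose[OF polyfun_on_det N entries] P_mult_GL[OF Z(1)]])
  show "flag_of n (P * Z) \<in> Abstract_Topology.closure_of (Fl_zariski n) (K_orbit p q (clan_flag p q \<gamma>))"
    using Z(2) by (simp add: in_Y_def clan_variety_def)
  show "det (N g) = 0" if "g \<in> GL n" "flag_of n g \<in> K_orbit p q (clan_flag p q \<gamma>)" for g
    using that vanish unfolding orbit_flag_iff by blast
qed

text \<open>Up to sign, \<open>det (N g)\<close> is the minor of \<open>\<pi> g\<close> in the columns \<open>U \<union> {a}\<close> that is nonzero on the curve.
  On the orbit these \<open>card U + 1\<close> columns lie in a space of dimension \<open>card U\<close>.\<close>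

lemma not_in_Y_lower_upper:
  assumes ab: "a < b" "b < n" and wa: "p \<le> w a" and wb: "w b < p"
  shows "\<not> in_Y (addrow_mat n 1 b a)"
proof
  assume Y: "in_Y (addrow_mat n 1 b a)"
  define U where "U = {c. c < a \<and> w c < p}"
  \<comment> \<open>Unit vectors fill the other columns so that at \<open>z = 1\<close> on the curve
    \<open>N\<close> is the permutation matrix of \<open>w\<close> with \<open>a\<close> and
    \<open>b\<close> exchanged: column \<open>a\<close> projects to the unit vector at
    \<open>w b\<close>, and column \<open>b\<close> supplies the one at \<open>w a\<close>.\<close>
  define N where "N g = mat n n (\<lambda>(r, c). if c \<in> insert a U then (if r < p then g $$ (r, c) else 0)
      else if c = b then (if r = w a then 1 else 0) else (if r = w c then 1 else 0))" for g :: "complex mat"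
  have "det (N (P * addrow_mat n 1 b a)) = 0"
  proof (rule det_vanishes_in_Y[OF _ _ _ addrow_mat_GL Y])
    show "N g \<in> carrier_mat n n" for g by (simp add: N_def)
    fix i j assume ij: "i < n" "j < n"
    consider "j \<in> insert a U" "i < p" | "\<not> (j \<in> insert a U \<and> i < p)" by blast
    then show "polyfun_on n (\<lambda>g. N g $$ (i, j))"
    proof cases
      case 1
      then have "(\<lambda>g. N g $$ (i, j)) = (\<lambda>g. g $$ (i, j))" using ij by (simp add: N_def)
      then show ?thesis using polyfun_on_entry[OF ij] by simp
    next
      case 2
      \<comment> \<open>These entries do not depend on \<open>g\<close>, so any argument, here the
        zero matrix, gives the constant.\<close>
      then have "(\<lambda>g. N g $$ (i, j)) = (\<lambda>g. N (0\<^sub>m n n) $$ (i, j))" using ij by (auto simp: N_def)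
      then show ?thesis using polyfun_on_const by metis
    qed
  next
    fix g k assume g: "g \<in> GL n" and k: "k \<in> block_K p q" and flag: "flag_of n g = flag_of n (k * X)"
    have kP: "k * P \<in> carrier_mat n n"
      using mult_carrier_mat[OF GL_carrier[OF block_K_GL[OF k]] perm_mat_carrier] .
    let ?Q = "\<lambda>c d. \<forall>r<n. (if r < p then g $$ (r, c) else 0)
        = ((k * P) *\<^sub>v vec n (\<lambda>s. if w s < p then d $ s else 0)) $ r"
    have "\<forall>c\<in>{..<n}. \<exists>d. d \<in> coord_space n (Suc c) \<and> ?Q c d"
      using orbit_column[OF GL_carrier[OF g] flag k] by (simp only: lessThan_iff Bex_def) simp
    from bchoice[OF this] obtain d where dQ: "\<forall>c\<in>{..<n}. d c \<in> coord_space n (Suc c) \<and> ?Q c (d c)" ..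
    have d: "d c \<in> coord_space n (Suc c)" if "c < n" for c
      using dQ that by simp
    have gd: "(if r < p then g $$ (r, c) else 0)
        = ((k * P) *\<^sub>v vec n (\<lambda>s. if w s < p then d c $ s else 0)) $ r" if "r < n" "c < n" for r c
      using dQ that by blast
    \<comment> \<open>The columns of \<open>k * P\<close> at \<open>U\<close> already span the
      projected columns at \<open>U\<close> and \<open>a\<close>. With \<open>Z\<close> holding the
      coefficients, column \<open>a\<close> of \<open>G\<close> can be taken to be zero.\<close>
    define G where "G = mat n n (\<lambda>(r, c). if c = a then 0 else if c \<in> U then (k * P) $$ (r, c) else N g $$ (r, c))"
    define Z where "Z = mat n n (\<lambda>(s, c). if c \<in> insert a U then (if w s < p then d c $ s else 0)
        else (if s = c then 1 else 0))"
    have "N g = G * Z"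
    proof (rule eq_matI)
      fix r c assume "r < dim_row (G * Z)" "c < dim_col (G * Z)"
      then have rc: "r < n" "c < n" by (auto simp: G_def Z_def)
      have GZ: "(G * Z) $$ (r, c) = (\<Sum>s = 0..<n. G $$ (r, s) * Z $$ (s, c))"
        using rc by (simp add: G_def Z_def scalar_prod_def)
      show "N g $$ (r, c) = (G * Z) $$ (r, c)"
      proof (cases "c \<in> insert a U")
        case True
        have "G $$ (r, s) * Z $$ (s, c) = (k * P) $$ (r, s) * vec n (\<lambda>s. if w s < p then d c $ s else 0) $ s"
          if s: "s < n" for s
        proof (cases "s \<in> U")
          case True
          then show ?thesis using rc s \<open>c \<in> _\<close> ab by (simp add: G_def Z_def) (simp add: U_def)
        next
          case False
          have "(if w s < p then d c $ s else 0) = 0"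
          proof (cases "w s < p")
            case True
            \<comment> \<open>Since \<open>a\<close> is a lower node, an upper node outside
              \<open>U\<close> lies strictly beyond \<open>a\<close>, past the support of
              \<open>d c\<close>.\<close>
            then have "a < s" using False wa by (metis (mono_tags) U_def linorder_neqE_nat mem_Collect_eq not_le)
            then have "Suc c \<le> s" using \<open>c \<in> insert a U\<close> by (auto simp: U_def)
            then show ?thesis using d[OF rc(2)] s by (auto simp: coord_space_def)
          qed simp
          then show ?thesis using rc s \<open>c \<in> insert a U\<close> by (simp add: Z_def)
        qed
        then have "(G * Z) $$ (r, c) = ((k * P) *\<^sub>v vec n (\<lambda>s. if w s < p then d c $ s else 0)) $ r"
          unfolding GZ by (subst mult_mat_vec_index[OF kP _ rc(1)]) (auto intro!: sum.cong)
        then show ?thesis using gd[OF rc] True rc by (simp add: N_def)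
      next
        case False
        then have "(\<Sum>s = 0..<n. G $$ (r, s) * Z $$ (s, c)) = (\<Sum>s = 0..<n. if c = s then N g $$ (r, s) else 0)"
          using rc by (intro sum.cong) (auto simp: G_def Z_def)
        then show ?thesis unfolding GZ using rc by simp
      qed
    qed (auto simp: N_def G_def Z_def)
    moreover have "det G = 0"
    proof -
      have "G *\<^sub>v unit_vec n a = 0\<^sub>v n"
      proof (rule eq_vecI)
        fix r assume "r < dim_vec (0\<^sub>v n)"
        then show "(G *\<^sub>v unit_vec n a) $ r = 0\<^sub>v n $ r"
          using ab mult_unit_vec_index[of G n r a] by (simp add: G_def)
      qed (simp add: G_def)
      then show ?thesis
        using ab by (subst det_0_iff_vec_prod_zero[of _ n])
          (auto simp: G_def intro!: exI[of _ "unit_vec n a"] unit_vec_nonzero)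
    qed
    moreover have "det (G * Z) = det G * det Z"
      by (rule det_mult[of _ n]) (simp_all add: G_def Z_def)
    ultimately show "det (N g) = 0" by simp
  qed (use ab in auto)
  moreover have "N (P * addrow_mat n 1 b a) = perm_mat n (w \<circ> Transposition.transpose a b)"
  proof (rule eq_matI)
    fix r c assume "r < dim_row (perm_mat n (w \<circ> Transposition.transpose a b))"
      "c < dim_col (perm_mat n (w \<circ> Transposition.transpose a b))"
    then have rc: "r < n" "c < n" by auto
    show "N (P * addrow_mat n 1 b a) $$ (r, c) = perm_mat n (w \<circ> Transposition.transpose a b) $$ (r, c)"
      using rc ab wa wb perm_lt[OF bij_w]
      by (auto simp: N_def U_def perm_mat_index P_mult_addrow_index Transposition.transpose_def simp del: index_mult_mat)
  qed (auto simp: N_def)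
  ultimately show False
    using perm_mat_transpose_GL[of a b] ab by (simp add: GL_iff)
qed

text \<open>The columns of \<open>N g\<close> up to \<open>b\<close> span the columns of \<open>g\<close> before \<open>b\<close> together with \<open>\<pi> g\<^sub>a\<close>, so
  \<open>det (N g) = 0\<close> expresses that \<open>\<pi> g\<^sub>a\<close> depends on those columns.\<close>

lemma in_Y_imp_under_arc:
  assumes ab: "a < b" "b < n" and wa: "w a < p" and wb: "p \<le> w b" and Y: "in_Y (addrow_mat n 1 b a)"
  shows "\<exists>i j. (Suc i, Suc j) \<in> arcs \<gamma> \<and> i \<le> a \<and> b \<le> j"
proof (rule ccontr)
  assume no: "\<not> ?thesis"
  \<comment> \<open>Column \<open>a\<close> of \<open>g\<close> is split into its lower part, kept
    in column \<open>a\<close>, and its upper part, put in column \<open>b\<close>. At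
    \<open>z = 1\<close> on the curve these are the unit vectors at \<open>w b\<close> and
    \<open>w a\<close>, which gives the same permutation matrix as before.\<close>
  define N where "N g = mat n n (\<lambda>(r, c). if c = a then (if r < p then 0 else g $$ (r, a))
      else if c = b then (if r < p then g $$ (r, a) else 0)
      else if c < b then g $$ (r, c) else (if r = w c then 1 else 0))" for g :: "complex mat"
  have "det (N (P * addrow_mat n 1 b a)) = 0"
  proof (rule det_vanishes_in_Y[OF _ _ _ addrow_mat_GL Y])
    show "N g \<in> carrier_mat n n" for g by (simp add: N_def)
    fix i j assume ij: "i < n" "j < n"
    have "(\<lambda>g. N g $$ (i, j)) = (\<lambda>g. if j = a then (if i < p then 0 else g $$ (i, a))
      else if j = b then (if i < p then g $$ (i, a) else 0)
      else if j < b then g $$ (i, j) else (if i = w j then 1 else 0))"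
      using ij by (simp add: N_def)
    moreover have "polyfun_on n (\<lambda>g. g $$ (i, a))" "polyfun_on n (\<lambda>g. g $$ (i, j))"
      using ab ij by (simp_all add: polyfun_on_entry)
    ultimately show "polyfun_on n (\<lambda>g. N g $$ (i, j))"
      by (cases "j = a"; cases "j = b"; cases "j < b"; cases "i < p") (simp_all add: polyfun_on_const)
  next
    fix g k assume g: "g \<in> GL n" and k: "k \<in> block_K p q" and flag: "flag_of n g = flag_of n (k * X)"
    note gc = GL_carrier[OF g] and kc = GL_carrier[OF block_K_GL[OF k]]
    have kP: "k * P \<in> carrier_mat n n" using mult_carrier_mat[OF kc perm_mat_carrier] .
    have kX: "k * X \<in> carrier_mat n n"
      using GL_carrier[OF GL_mult[OF block_K_GL[OF k] P_mult_GL[OF arc_mat_GL]]] .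
    obtain d where d: "d \<in> coord_space n (Suc a)" and gd: "\<And>r. r < n \<Longrightarrow> (if r < p then g $$ (r, a) else 0)
        = ((k * P) *\<^sub>v vec n (\<lambda>s. if w s < p then d $ s else 0)) $ r"
      using orbit_column[OF gc flag k, of a] ab by auto
    \<comment> \<open>The preimage under the arc matrix of \<open>d\<close> truncated to upper
      nodes: each arc adds the coordinate of its left end to that of its right end, which must
      therefore start as the negative.\<close>
    define y where "y = vec n (\<lambda>r. if w r < p then d $ r
        else if \<exists>c. (Suc c, Suc r) \<in> arcs \<gamma> then - d $ (THE c. (Suc c, Suc r) \<in> arcs \<gamma>) else 0)"
    have y_arc: "y $ r = - d $ c" if cr: "(Suc c, Suc r) \<in> arcs \<gamma>" for c r
    proof -
      have "(THE c. (Suc c, Suc r) \<in> arcs \<gamma>) = c"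
      proof (rule the_equality)
        show "(Suc c, Suc r) \<in> arcs \<gamma>" by (rule cr)
        fix c' assume "(Suc c', Suc r) \<in> arcs \<gamma>"
        from arc_unique[OF cr this] show "c' = c" by simp
      qed
      moreover have "r < n" "\<not> w r < p" using right_end_lower[OF cr] arc_bounds[OF cr] by simp_all
      moreover have "\<exists>c. (Suc c, Suc r) \<in> arcs \<gamma>" using cr by blast
      ultimately show ?thesis by (simp add: y_def)
    qed
    have y: "y \<in> coord_space n b"
      unfolding coord_space_def
    proof (intro CollectI conjI allI impI)
      show "y \<in> carrier_vec n" by (simp add: y_def)
      fix r assume r: "r < n" "b \<le> r"
      show "y $ r = 0"
      proof (cases "\<exists>c. (Suc c, Suc r) \<in> arcs \<gamma>")
        case True
        then obtain c where cr: "(Suc c, Suc r) \<in> arcs \<gamma>" by blast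
        \<comment> \<open>An arc ending at or beyond \<open>b\<close> starts after \<open>a\<close>,
          since none covers \<open>a < b\<close>; the coordinate of \<open>d\<close> there is
          zero.\<close>
        then have "\<not> c \<le> a" using no r by blast
        moreover have "c < n" using arc_bounds[OF cr] by simp
        ultimately show ?thesis using y_arc[OF cr] d by (simp add: coord_space_def)
      next
        case False
        then show ?thesis using r ab d by (simp add: y_def coord_space_def)
      qed
    qed
    then have yc: "y \<in> carrier_vec n" by (simp add: coord_space_def)
    have Ay: "arc_mat (\<lambda>_. 1) *\<^sub>v y = vec n (\<lambda>s. if w s < p then d $ s else 0)"
    proof (rule eq_vecI)
      fix r assume "r < dim_vec (vec n (\<lambda>s. if w s < p then d $ s else 0))"
      then have r: "r < n" by simp
      show "(arc_mat (\<lambda>_. 1) *\<^sub>v y) $ r = vec n (\<lambda>s. if w s < p then d $ s else 0) $ r"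
      proof (cases "\<exists>c. (Suc c, Suc r) \<in> arcs \<gamma>")
        case True
        then obtain c where cr: "(Suc c, Suc r) \<in> arcs \<gamma>" by blast
        have "c < n" using arc_bounds[OF cr] by simp
        then have "y $ c = d $ c" using left_end_upper[OF cr] by (simp add: y_def)
        then show ?thesis
          using arc_mat_mult_vec_arc[OF yc cr, of "\<lambda>_. 1"] y_arc[OF cr] right_end_lower[OF cr] r by simp
      next
        case False
        then show ?thesis using arc_mat_mult_vec_no_arc[OF yc r, of "\<lambda>_. 1"] r by (simp add: y_def)
      qed
    qed (simp add: arc_mat_def)
    have "(k * X) *\<^sub>v y = (k * P) *\<^sub>v vec n (\<lambda>s. if w s < p then d $ s else 0)"
      unfolding assoc_mult_mat[OF kc perm_mat_carrier arc_mat_carrier, symmetric] Ay[symmetric]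
      by (rule assoc_mult_mat_vec[OF kP arc_mat_carrier yc])
    moreover have "(k * X) *\<^sub>v y \<in> flag_of n g b"
      unfolding flag flag_of_eq[OF kX] using y by blast
    ultimately obtain c where c: "c \<in> coord_space n b"
      and gcv: "(k * P) *\<^sub>v vec n (\<lambda>s. if w s < p then d $ s else 0) = g *\<^sub>v c"
      unfolding flag_of_eq[OF gc] by auto
    have cc: "c \<in> carrier_vec n" using c by (simp add: coord_space_def)
    \<comment> \<open>Weighting the lower part of column \<open>a\<close> by \<open>c $ a\<close>
      and the upper part by \<open>c $ a - 1\<close> yields \<open>g\<close> applied to
      \<open>c\<close> minus the upper part, which is zero. The entries of \<open>e\<close> at
      \<open>a\<close> and \<open>b\<close> differ by 1, so \<open>e\<close> is not zero.\<close>
    define e where "e = vec n (\<lambda>s. if s = b then c $ a - 1 else c $ s)"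
    have Nc: "N g \<in> carrier_mat n n" and ec: "e \<in> carrier_vec n"
      by (simp_all add: N_def e_def)
    have "N g *\<^sub>v e = 0\<^sub>v n"
    proof (rule eq_vecI)
      fix r assume "r < dim_vec (0\<^sub>v n)"
      then have r: "r < n" by simp
      let ?x = "if r < p then g $$ (r, a) else 0"
      have "(N g *\<^sub>v e) $ r = (\<Sum>s = 0..<n. N g $$ (r, s) * e $ s)"
        by (rule mult_mat_vec_index) (use r in \<open>simp_all add: N_def e_def\<close>)
      also have "\<dots> = (\<Sum>s = 0..<n. g $$ (r, s) * c $ s
          + ((if a = s then - ?x * c $ a else 0) + (if b = s then ?x * (c $ a - 1) else 0)))"
      proof (rule sum.cong)
        fix s assume s: "s \<in> {0..<n}"
        have "c $ s = 0" if "b \<le> s" using c that s by (simp add: coord_space_def)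
        then show "N g $$ (r, s) * e $ s = g $$ (r, s) * c $ s
            + ((if a = s then - ?x * c $ a else 0) + (if b = s then ?x * (c $ a - 1) else 0))"
          using r s ab by (auto simp: N_def e_def)
      qed simp
      also have "\<dots> = (g *\<^sub>v c) $ r + (- ?x * c $ a + ?x * (c $ a - 1))"
        unfolding sum.distrib mult_mat_vec_index[OF gc cc r] using ab by simp
      also have "\<dots> = 0" unfolding gcv[symmetric] gd[OF r, symmetric] by (simp add: algebra_simps)
      finally show "(N g *\<^sub>v e) $ r = 0\<^sub>v n $ r" using r by simp
    qed (simp add: N_def)
    moreover have "e \<noteq> 0\<^sub>v n"
    proof
      assume e0: "e = 0\<^sub>v n"
      have "e $ b = 0" "e $ a = 0" using e0 ab by simp_all
      then show False using ab by (simp add: e_def)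
    qed
    ultimately show "det (N g) = 0"
      using det_0_iff_vec_prod_zero[OF Nc] ec by blast
  qed (use ab in auto)
  moreover have "N (P * addrow_mat n 1 b a) = perm_mat n (w \<circ> Transposition.transpose a b)"
  proof (rule eq_matI)
    fix r c assume "r < dim_row (perm_mat n (w \<circ> Transposition.transpose a b))"
      "c < dim_col (perm_mat n (w \<circ> Transposition.transpose a b))"
    then have rc: "r < n" "c < n" by auto
    show "N (P * addrow_mat n 1 b a) $$ (r, c) = perm_mat n (w \<circ> Transposition.transpose a b) $$ (r, c)"
      using rc ab wa wb perm_lt[OF bij_w]
      by (auto simp: N_def perm_mat_index P_mult_addrow_index Transposition.transpose_def simp del: index_mult_mat)
  qed (auto simp: N_def)
  ultimately show False
    using perm_mat_transpose_GL[of a b] ab by (simp add: GL_iff)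
qed

end

section \<open>The criterion for the curve, translated to nodes counted from 0\<close>

theorem theorem5p3:
  fixes p q a b :: nat and \<gamma> :: clan and v :: "nat \<Rightarrow> nat"
  assumes "p \<ge> 1" and "q \<ge> 1"
    and "is_clan p q \<gamma>"
    and "v = clan_perm p \<gamma>"
    and "1 \<le> a" and "a < b" and "b \<le> p + q"
  shows "T_curve (p + q) v a b \<subseteq> clan_variety p q \<gamma> \<longleftrightarrow>
           (max (v a) (v b) \<le> p \<or> min (v a) (v b) > p) \<or>
           (v a \<le> p \<and> p < v b \<and> (\<exists>i j. (i, j) \<in> arcs \<gamma> \<and> i \<le> a \<and> b \<le> j))"
proof -
  interpret clan_setup p q \<gamma> by unfold_locales (rule assms(3))
  define a' b' where "a' = a - 1" and "b' = b - 1"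
  have ab: "a = Suc a'" "b = Suc b'" "a' < b'" "b' < p + q"
    using assms(5-7) by (auto simp: a'_def b'_def)
  have va: "v a \<le> p \<longleftrightarrow> w a' < p" and vb: "v b \<le> p \<longleftrightarrow> w b' < p"
    using clan_perm_le_iff w_less_iff ab assms(4) by auto
  have arc: "(\<exists>i j. (i, j) \<in> arcs \<gamma> \<and> i \<le> a \<and> b \<le> j) \<longleftrightarrow>
      (\<exists>i j. (Suc i, Suc j) \<in> arcs \<gamma> \<and> i \<le> a' \<and> b' \<le> j)"
  proof
    assume "\<exists>i j. (i, j) \<in> arcs \<gamma> \<and> i \<le> a \<and> b \<le> j"
    then obtain i j where ij: "(i, j) \<in> arcs \<gamma>" "i \<le> a" "b \<le> j" by blast
    from arc_bounds[OF ij(1)] obtain i' j' where "i = Suc i'" "j = Suc j'"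
      by (metis One_nat_def Suc_le_D less_trans_Suc order_less_imp_le)
    with ij ab show "\<exists>i j. (Suc i, Suc j) \<in> arcs \<gamma> \<and> i \<le> a' \<and> b' \<le> j" by auto
  next
    assume "\<exists>i j. (Suc i, Suc j) \<in> arcs \<gamma> \<and> i \<le> a' \<and> b' \<le> j"
    then show "\<exists>i j. (i, j) \<in> arcs \<gamma> \<and> i \<le> a \<and> b \<le> j" unfolding ab by (meson Suc_le_mono)
  qed
  have "T_curve (p + q) v a b \<subseteq> clan_variety p q \<gamma> \<longleftrightarrow> (\<forall>z. in_Y (addrow_mat (p + q) z b' a'))"
    using T_curve_subset_iff[OF assms(5-7)] by (simp add: assms(4) a'_def b'_def)
  also have "\<dots> \<longleftrightarrow> (w a' < p \<longleftrightarrow> w b' < p) \<or>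
      (w a' < p \<and> p \<le> w b' \<and> (\<exists>i j. (Suc i, Suc j) \<in> arcs \<gamma> \<and> i \<le> a' \<and> b' \<le> j))"
  proof
    assume Y: "\<forall>z. in_Y (addrow_mat (p + q) z b' a')"
    \<comment> \<open>The single point \<open>z = 1\<close> rules out both failing cases.\<close>
    then show "(w a' < p \<longleftrightarrow> w b' < p) \<or>
        (w a' < p \<and> p \<le> w b' \<and> (\<exists>i j. (Suc i, Suc j) \<in> arcs \<gamma> \<and> i \<le> a' \<and> b' \<le> j))"
      using not_in_Y_lower_upper[OF ab(3,4)] in_Y_imp_under_arc[OF ab(3,4)] by (meson not_le)
  next
    assume "(w a' < p \<longleftrightarrow> w b' < p) \<or>
        (w a' < p \<and> p \<le> w b' \<and> (\<exists>i j. (Suc i, Suc j) \<in> arcs \<gamma> \<and> i \<le> a' \<and> b' \<le> j))"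
    then show "\<forall>z. in_Y (addrow_mat (p + q) z b' a')"
      using in_Y_same_side[OF ab(3,4)] in_Y_under_arc[OF _ _ ab(3)] by blast
  qed
  finally show ?thesis using va vb arc by (auto simp: not_le not_less)
qed

end
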